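(* Let $0\le\gamma\le\alpha\le 1$ and fix $n\in\mathbb{N}$. Let $(T_n(m))_{m\in\mathbb{N}_0}$ be the $(\alpha,\gamma)$-chain on $\mathbb{T}_{[n]}$ and let $T_n$ be the $n$th step of the $(\alpha,\gamma)$-growth process. Then $T_n(m)\to T_n$ in distribution as $m\to\infty$.
   Context: Trees. $[n]=\{1,\dots,n\}$. For a finite set $A\subset\mathbb{N}$, $\mathbb{T}_A$ is the set of rooted non-planar trees whose leaves are labelled bijectively by $A$, with one additional vertex of degree 1 called the root (not a leaf), and all of whose other vertices, called branch points, have degree at least 3 (trees are identified up to label- and root-preserving isomorphism). Parents and children are taken with respect to the root. An edge is external if it ends in a leaf and internal otherwise. $\mathrm{ins}(t)$ is the set of all edges and branch points of $t$. Inserting a leaf $j$ at a branch point $v$: add leaf $j$ as a new child of $v$. Inserting $j$ at an edge: subdivide the edge by a new branch point and attach leaf $j$ to it. Deleting a leaf: remove it and its edge; if its parent had only 2 children, that parent is suppressed (its two remaining edges are merged). For a leaf $i$, let $v_1,v_2,\dots$ be the successive branch points on the path from $i$ to the root ($v_1$ the parent of $i$). The $r$th spinal bush on the ancestral line from $i$ is the collection of subtrees of $v_r$ not containing $i$. $(\alpha,\gamma)$-growth process. $T_1$ is the unique element of $\mathbb{T}_{[1]}$; given $T_n=s$, $T_{n+1}$ is obtained by inserting leaf $n+1$ at $x\in\mathrm{ins}(s)$ with probability $w_x/(n-\alpha)$, where $w_x=1-\alpha$ if $x$ is an external edge, $w_x=\gamma$ if $x$ is an internal edge, $w_x=(c_x-1)\alpha-\gamma$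 if $x$ is a branch point with $c_x$ children. ($T_2$ is the unique element of $\mathbb{T}_{[2]}$, also if $\alpha=1$.) $(\alpha,\gamma)$-chain on $\mathbb{T}_{[n]}$. For $n=1$ it is constant. For $n\ge2$ it is the Markov chain on $\mathbb{T}_{[n]}$ with the following transition from $t$: (i) Select $I$ uniformly from $[n]$; say $I=i$. Let $v$ be the parent of leaf $i$ and $c_v$ its number of children. (ii) If $c_v=2$, put $\tilde I=\max\{i,a,b\}$, where $a$ and $b$ are the least leaf labels in the first and second spinal bush on the ancestral line from $i$ ($b=0$ if there is no second one). If $c_v>2$, let $i_1<\dots<i_{c_v}$ be the least leaf labels of the $c_v$ subtrees of $v$ and let $i=i_j$. With $D=(c_v-2)\alpha-\gamma$, let $\tilde I=i_{j'}$ with conditional probability $\frac{\alpha-\gamma}{D}$ if $j\le2$, $j'=3$; $\frac{\alpha}{D}$ if $j\le2$, $3<j'\le c_v$; $\frac{\alpha}{D}$ if $2<j<j'\le c_v$; $\frac{(j-2)\alpha-\gamma}{D}$ if $2<j=j'\le c_v$; and $0$ otherwise. (If $c_v=3$ this is read as $\tilde I=i_3$; if $\alpha=\gamma=0$ and $c_v>3$ the fractions are read as their limits as $\alpha=\gamma\downarrow0$.) (iii) Swap the labels $i$ and $\tilde I$, then delete the leaf now labelled $\tilde I$. (iv) Relabel $\tilde I+1,\dots,n$ by $\tilde I,\dots,n-1$ increasingly, giving an element of $\mathbb{T}_{[n-1]}$. (v) Insert leaf $n$ according to the step of the $(\alpha,\gamma)$-growth process from $\mathbb{T}_{[n-1]}$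 to $\mathbb{T}_{[n]}$. *)

theory Defs
  imports "HOL-Probability.Probability" "HOL-Library.FSet" "HOL-Library.Monad_Syntax"
    "HOL-Combinatorics.Transposition"
begin

section \<open>Leaf-labelled rooted trees\<close>

text \<open>
  A non-planar tree with a degree-one root is represented by the tree hanging below the edge at the
  root; the root itself is implicit. As the children of a branch point form a finite set,
  two trees with distinct leaf labels are equal iff they are isomorphic by a label- and
  root-preserving map. Each vertex other than the root is identified with the subtree below it, and
  each edge with the subtree below its lower end; in a tree with distinct leaf labels distinct
  vertices have distinct subtrees.
\<close>

datatype (leaves: 'a) ltree = Leaf 'a | Node (children: "'a ltree fset")
  where "children (Leaf _) = {||}"

primrec subtrees :: "'a ltree \<Rightarrow> 'a ltree set" where
  "subtrees (Leaf i) = {Leaf i}"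
| "subtrees (Node ts) = insert (Node ts) (\<Union> (fset (subtrees |`| ts)))"

text \<open>A branch point has degree at least 3, that is, at least two children. Disjointness of the
  label sets of siblings makes the labelling of the leaves injective.\<close>

inductive proper_tree :: "'a ltree \<Rightarrow> bool" where
  "proper_tree (Leaf i)"
| "\<lbrakk>fcard ts \<ge> 2; \<And>t. t |\<in>| ts \<Longrightarrow> proper_tree t; disjoint_family_on leaves (fset ts)\<rbrakk>
    \<Longrightarrow> proper_tree (Node ts)"

definition trees :: "'a set \<Rightarrow> 'a ltree set" where
  "trees A = {t. proper_tree t \<and> leaves t = A}"

definition parent :: "'a ltree \<Rightarrow> 'a ltree \<Rightarrow> 'a ltree option" where
  "parent t s = (if \<exists>v \<in> subtrees t. s |\<in>| children v
     then Some (THE v. v \<in> subtrees t \<and> s |\<in>| children v) else None)"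

text \<open>\<open>subst s r t\<close> replaces the subtree \<open>s\<close> of \<open>t\<close> by \<open>r\<close>.\<close>

primrec subst :: "'a ltree \<Rightarrow> 'a ltree \<Rightarrow> 'a ltree \<Rightarrow> 'a ltree" where
  "subst s r (Leaf i) = (if Leaf i = s then r else Leaf i)"
| "subst s r (Node ts) = (if Node ts = s then r else Node (subst s r |`| ts))"

text \<open>\<open>Edge s\<close> is the edge from the subtree \<open>s\<close> up to its parent (or up to the root);
  \<open>Branch ts\<close> is the branch point whose set of children is \<open>ts\<close>.\<close>

datatype 'a site = Edge "'a ltree" | Branch "'a ltree fset"

definition ins :: "'a ltree \<Rightarrow> 'a site set" where
  "ins t = Edge ` subtrees t \<union> Branch ` {ts. Node ts \<in> subtrees t}"

fun insert_leaf :: "'a \<Rightarrow> 'a site \<Rightarrow> 'a ltree \<Rightarrow> 'a ltree" where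
  "insert_leaf j (Edge s) t = subst s (Node {|Leaf j, s|}) t"
| "insert_leaf j (Branch ts) t = subst (Node ts) (Node (finsert (Leaf j) ts)) t"

text \<open>Only meaningful if leaf \<open>j\<close> has a parent, i.e. if \<open>t\<close> has at least two leaves.\<close>

definition delete_leaf :: "'a \<Rightarrow> 'a ltree \<Rightarrow> 'a ltree" where
  "delete_leaf j t =
    (let v = the (parent t (Leaf j)); us = children v |-| {|Leaf j|}
     in subst v (if fcard (children v) = 2 then fthe_elem us else Node us) t)"

text \<open>\<open>ancestor t i r\<close> is the branch point \<open>v\<^sub>r\<close> for \<open>r \<ge> 1\<close>, and the leaf \<open>i\<close> itself for \<open>r = 0\<close>.\<close>

primrec ancestor :: "'a ltree \<Rightarrow> 'a \<Rightarrow> nat \<Rightarrow> 'a ltree option" where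
  "ancestor t i 0 = Some (Leaf i)"
| "ancestor t i (Suc r) = Option.bind (ancestor t i r) (parent t)"

definition spinal_bush :: "'a ltree \<Rightarrow> 'a \<Rightarrow> nat \<Rightarrow> 'a ltree set" where
  "spinal_bush t i r = (case ancestor t i r of
      None \<Rightarrow> {} | Some v \<Rightarrow> {u \<in> fset (children v). i \<notin> leaves u})"

text \<open>The value 0 on the empty set is the convention \<open>b = 0\<close> for a missing second spinal bush.\<close>

definition least_label :: "nat ltree set \<Rightarrow> nat" where
  "least_label S = (if S = {} then 0 else Min (\<Union>u\<in>S. leaves u))"

section \<open>The growth process\<close>

fun weight :: "real \<Rightarrow> real \<Rightarrow> 'a site \<Rightarrow> real" where
  "weight \<alpha> \<gamma> (Edge s) = (if is_Leaf s then 1 - \<alpha> else \<gamma>)"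
| "weight \<alpha> \<gamma> (Branch ts) = (real (fcard ts) - 1) * \<alpha> - \<gamma>"

text \<open>For \<open>n = 1\<close> the only site is the external edge; it is treated separately because for
  \<open>\<alpha> = 1\<close> its weight and the total weight \<open>n - \<alpha>\<close> both vanish.\<close>

definition growth_step :: "real \<Rightarrow> real \<Rightarrow> nat \<Rightarrow> nat ltree \<Rightarrow> nat ltree pmf" where
  "growth_step \<alpha> \<gamma> n s =
    (if n = 1 then return_pmf (Node {|Leaf 1, Leaf 2|})
     else map_pmf (\<lambda>x. insert_leaf (n + 1) x s)
       (embed_pmf (\<lambda>x. if x \<in> ins s then weight \<alpha> \<gamma> x / (real n - \<alpha>) else 0)))"

text \<open>\<open>X\<close> is a (time-inhomogeneous) Markov process with values \<open>X m \<in> S m\<close>, arbitrary initial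
  distribution, and transition kernel \<open>K m\<close> from time \<open>m\<close> to time \<open>m + 1\<close>.\<close>

definition markov_process ::
  "'w measure \<Rightarrow> (nat \<Rightarrow> 'a set) \<Rightarrow> (nat \<Rightarrow> 'a \<Rightarrow> 'a pmf) \<Rightarrow> (nat \<Rightarrow> 'w \<Rightarrow> 'a) \<Rightarrow> bool" where
  "markov_process M S K X \<longleftrightarrow>
     prob_space M \<and>
     (\<forall>m. X m \<in> measurable M (count_space (S m))) \<and>
     (\<forall>m x. (\<forall>k\<le>Suc m. x k \<in> S k) \<longrightarrow>
        measure M {\<omega> \<in> space M. \<forall>k\<le>Suc m. X k \<omega> = x k} =
        measure M {\<omega> \<in> space M. \<forall>k\<le>m. X k \<omega> = x k} * pmf (K m (x m)) (x (Suc m)))"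

text \<open>Time starts at 1, whence the shift (\<open>T 0\<close> is irrelevant). The initial value is prescribed by
  the state space at time 1, as \<open>trees {1..1}\<close> contains a single tree.\<close>

definition growth_process ::
  "real \<Rightarrow> real \<Rightarrow> 'w measure \<Rightarrow> (nat \<Rightarrow> 'w \<Rightarrow> nat ltree) \<Rightarrow> bool" where
  "growth_process \<alpha> \<gamma> M T \<longleftrightarrow>
     markov_process M (\<lambda>m. trees {1..Suc m}) (\<lambda>m. growth_step \<alpha> \<gamma> (Suc m)) (\<lambda>m. T (Suc m))"

section \<open>The chain\<close>

definition swap_frac :: "real \<Rightarrow> real \<Rightarrow> nat \<Rightarrow> nat \<Rightarrow> nat \<Rightarrow> real" where
  "swap_frac \<alpha> \<gamma> c j j' =
    (let D = (real c - 2) * \<alpha> - \<gamma> in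
     if j \<le> 2 \<and> j' = 3 then (\<alpha> - \<gamma>) / D
     else if j \<le> 2 \<and> 3 < j' \<and> j' \<le> c then \<alpha> / D
     else if 2 < j \<and> j < j' \<and> j' \<le> c then \<alpha> / D
     else if 2 < j \<and> j = j' \<and> j' \<le> c then ((real j - 2) * \<alpha> - \<gamma>) / D
     else 0)"

definition swap_prob :: "real \<Rightarrow> real \<Rightarrow> nat \<Rightarrow> nat \<Rightarrow> nat \<Rightarrow> real" where
  "swap_prob \<alpha> \<gamma> c j j' =
    (if c = 3 then (if j' = 3 then 1 else 0)
     else if \<alpha> = 0 \<and> \<gamma> = 0 then Lim (at_right 0) (\<lambda>a. swap_frac a a c j j')
     else swap_frac \<alpha> \<gamma> c j j')"

text \<open>The conditional law of the label swapped with \<open>i\<close>, given that \<open>i\<close> is selected.\<close>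

definition swap_label :: "real \<Rightarrow> real \<Rightarrow> nat ltree \<Rightarrow> nat \<Rightarrow> nat pmf" where
  "swap_label \<alpha> \<gamma> t i =
    (let v = the (parent t (Leaf i)); c = fcard (children v) in
     if c = 2 then
       return_pmf (Max {i, least_label (spinal_bush t i 1), least_label (spinal_bush t i 2)})
     else
       (let L = sorted_list_of_set ((\<lambda>u. least_label {u}) ` fset (children v));
            lab = (\<lambda>k. L ! (k - 1));
            j = (THE k. k \<in> {1..c} \<and> lab k = i)
        in map_pmf lab (embed_pmf (swap_prob \<alpha> \<gamma> c j))))"

definition chain_step :: "real \<Rightarrow> real \<Rightarrow> nat \<Rightarrow> nat ltree \<Rightarrow> nat ltree pmf" where
  "chain_step \<alpha> \<gamma> n t =
    (if n = 1 then return_pmf t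
     else do {
       i \<leftarrow> pmf_of_set {1..n};
       k \<leftarrow> swap_label \<alpha> \<gamma> t i;
       let t' = delete_leaf k (map_ltree (Transposition.transpose i k) t);
       growth_step \<alpha> \<gamma> (n - 1) (map_ltree (\<lambda>l. if k < l then l - 1 else l) t')
     })"

definition alpha_gamma_chain ::
  "real \<Rightarrow> real \<Rightarrow> nat \<Rightarrow> 'w measure \<Rightarrow> (nat \<Rightarrow> 'w \<Rightarrow> nat ltree) \<Rightarrow> bool" where
  "alpha_gamma_chain \<alpha> \<gamma> n M X \<longleftrightarrow>
     markov_process M (\<lambda>_. trees {1..n}) (\<lambda>_. chain_step \<alpha> \<gamma> n) X"

text \<open>Convergence in distribution for random variables with values in a discrete space, where every
  function is continuous, so that all bounded real functions are test functions. The limit may live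
  on a different probability space.\<close>

definition converges_in_distribution ::
  "'w measure \<Rightarrow> (nat \<Rightarrow> 'w \<Rightarrow> 'a) \<Rightarrow> 'v measure \<Rightarrow> ('v \<Rightarrow> 'a) \<Rightarrow> bool" where
  "converges_in_distribution M X N Y \<longleftrightarrow>
     (\<forall>f :: 'a \<Rightarrow> real. bounded (range f) \<longrightarrow>
        (\<lambda>m. \<integral>\<omega>. f (X m \<omega>) \<partial>M) \<longlonglongrightarrow> (\<integral>\<omega>. f (Y \<omega>) \<partial>N))"

end

theory Submission
  imports Defs
begin

text \<open>
  Let \<open>U\<close> be the growth step from \<open>m \<ge> 2\<close> to \<open>m + 1\<close> leaves, \<open>D\<close> the down step (select, swap,
  delete, relabel) from \<open>m + 1\<close> to \<open>m\<close> leaves, and \<open>K\<close> the chain on trees with \<open>m\<close> leaves. Given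
  the selected leaf \<open>i \<le> m\<close>, the cases in which the new leaf \<open>m + 1\<close> is swapped with \<open>i\<close> carry
  total weight exactly 1, and then the down step undoes the insertion; the remaining weights are
  those of the insertion sites after \<open>i\<close> has been removed. Hence \<open>U D = p Id + (1 - p) K\<close>, where
  \<open>p = (1 + m / (m - \<alpha>)) / (m + 1)\<close> does not depend on the tree. The chain with \<open>m + 1\<close> leaves
  has the powers \<open>D (U D)\<^sup>r U\<close>, so its convergence follows from that of the lazy version of \<open>K\<close>,
  by induction on the number of leaves. Neither irreducibility nor stationarity has to be studied
  separately, which covers all boundary values of \<open>\<alpha>\<close> and \<open>\<gamma>\<close>.
\<close>

section \<open>Subtrees and insertion sites\<close>

text \<open>The weights and the swap fractions fit together at the parent of the selected leaf
  \<open>i\<close>. If the parent has two children, the new leaf is picked for sure when inserted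
  above the parent, at the parent or on the edge of \<open>i\<close>, with weights \<gamma> +
  (\<alpha> - \<gamma>) + (1 - \<alpha>) = 1. If it has \<open>c > 2\<close> children, its weight
  \<open>(c - 1) * \<alpha> - \<gamma>\<close> splits into \<alpha>, for which the new leaf is
  picked, and \<open>(c - 2) * \<alpha> - \<gamma>\<close>, its weight without \<open>i\<close>; the
  edge of \<open>i\<close> supplies the missing 1 - \<alpha>. All other sites keep their weights
  when \<open>i\<close> is removed, so the identity passes from subtrees to trees. The obstacle to
  this induction is the second spinal bush, which can lie outside the subtree at hand: its least
  label is carried along as a parameter \<open>b\<close>, over which the induction quantifies. A
  second obstacle is that denominators can vanish (\<open>n - \<alpha>\<close> for one leaf, or the
  one in the swap rule); the identities are therefore stated with unnormalised weights.\<close>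

lemma proper_tree_Node_iff:
  "proper_tree (Node ts) \<longleftrightarrow>
     fcard ts \<ge> 2 \<and> (\<forall>t. t |\<in>| ts \<longrightarrow> proper_tree t) \<and> disjoint_family_on leaves (fset ts)"
  by (subst proper_tree.simps) auto

lemma finite_leaves [simp]: "finite (leaves t)"
  by (induction t) auto

lemma finite_subtrees [simp]: "finite (subtrees t)"
  by (induction t) auto

lemma leaves_nonempty: "proper_tree t \<Longrightarrow> leaves t \<noteq> {}"
proof (induction rule: proper_tree.induct)
  case (2 ts)
  then obtain u where "u |\<in>| ts"
    by (metis fcard_fempty fempty_iff fset_eqI not_numeral_le_zero)
  with 2 show ?case by auto
qed auto

lemma proper_tree_child: "proper_tree (Node ts) \<Longrightarrow> u |\<in>| ts \<Longrightarrow> proper_tree u"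
  by (simp add: proper_tree_Node_iff)

lemma siblings_disjoint:
  "proper_tree (Node ts) \<Longrightarrow> u |\<in>| ts \<Longrightarrow> w |\<in>| ts \<Longrightarrow> u \<noteq> w \<Longrightarrow> leaves u \<inter> leaves w = {}"
  by (auto simp: proper_tree_Node_iff disjoint_family_on_def)

lemma sibling_unique:
  "proper_tree (Node ts) \<Longrightarrow> u |\<in>| ts \<Longrightarrow> w |\<in>| ts \<Longrightarrow> l \<in> leaves u \<Longrightarrow> l \<in> leaves w \<Longrightarrow> u = w"
  using siblings_disjoint by blast

lemma sibling_exists:
  assumes "proper_tree (Node ts)" "u |\<in>| ts"
  obtains w where "w |\<in>| ts" "w \<noteq> u"
proof -
  have "card (fset ts - {u}) \<ge> 1"
    using assms by (auto simp: proper_tree_Node_iff fcard.rep_eq)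
  then have "fset ts - {u} \<noteq> {}" by (intro notI) simp
  then show ?thesis using that by auto
qed

lemma leaves_child_psubset:
  assumes "proper_tree (Node ts)" "u |\<in>| ts"
  shows "leaves u \<subset> leaves (Node ts)"
proof -
  obtain w where w: "w |\<in>| ts" "w \<noteq> u" using sibling_exists assms by blast
  have "leaves w \<noteq> {}" using assms(1) w(1) leaves_nonempty proper_tree_child by blast
  moreover have "leaves u \<inter> leaves w = {}" using siblings_disjoint assms w by blast
  ultimately show ?thesis using assms(2) w(1) by fastforce
qed

lemma subtrees_refl [simp]: "t \<in> subtrees t"
  by (cases t) auto

lemma subtrees_trans: "s \<in> subtrees u \<Longrightarrow> u \<in> subtrees t \<Longrightarrow> s \<in> subtrees t"
  by (induction t) auto

lemma children_subtrees: "s |\<in>| children v \<Longrightarrow> s \<in> subtrees v"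
  by (cases v) (auto intro!: bexI[of _ s])

lemma leaves_subtrees: "s \<in> subtrees t \<Longrightarrow> leaves s \<subseteq> leaves t"
  by (induction t) auto

lemma proper_tree_subtrees: "proper_tree t \<Longrightarrow> s \<in> subtrees t \<Longrightarrow> proper_tree s"
  by (induction t) (auto dest: proper_tree_child)

lemma Leaf_in_subtrees_iff [simp]: "Leaf i \<in> subtrees t \<longleftrightarrow> i \<in> leaves t"
  by (induction t) auto

lemma leaves_children_psubset:
  "proper_tree v \<Longrightarrow> s |\<in>| children v \<Longrightarrow> leaves s \<subset> leaves v"
  by (cases v) (auto dest: leaves_child_psubset)

lemma Node_notin_subtrees_child:
  "proper_tree (Node ts) \<Longrightarrow> u |\<in>| ts \<Longrightarrow> Node ts \<notin> subtrees u"
  using leaves_child_psubset leaves_subtrees by blast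

text \<open>This is what justifies identifying a vertex with the subtree below it: a subtree has at
  least one label, and a label occurs below only one sibling.\<close>

lemma subtrees_sibling_unique:
  "proper_tree (Node ts) \<Longrightarrow> u |\<in>| ts \<Longrightarrow> w |\<in>| ts \<Longrightarrow> s \<in> subtrees u \<Longrightarrow> s \<in> subtrees w
     \<Longrightarrow> u = w"
  by (metis (full_types) equals0I leaves_nonempty leaves_subtrees proper_tree_child
      proper_tree_subtrees sibling_unique subsetD)

lemma parent_Node_child:
  assumes "proper_tree (Node ts)" "u |\<in>| ts"
  shows "parent (Node ts) u = Some (Node ts)"
proof -
  have "v = Node ts" if v: "v \<in> subtrees (Node ts)" "u |\<in>| children v" for v
  proof (rule ccontr)
    assume "v \<noteq> Node ts"
    then obtain w where w: "w |\<in>| ts" "v \<in> subtrees w" using v by auto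
    then have "u = w"
      using subtrees_sibling_unique[OF assms w(1), of u] subtrees_trans children_subtrees v(2)
        by (metis subtrees_refl)
    moreover have "leaves u \<subset> leaves v"
      using leaves_children_psubset proper_tree_subtrees assms(1) v by blast
    ultimately show False using leaves_subtrees w(2) by blast
  qed
  then have "(THE v. v \<in> subtrees (Node ts) \<and> u |\<in>| children v) = Node ts"
    using assms(2) by (intro the_equality) auto
  moreover have "\<exists>v\<in>subtrees (Node ts). u |\<in>| children v" using assms(2) by auto
  ultimately show ?thesis unfolding parent_def by simp
qed

text \<open>Gives all notions built on \<open>parent\<close> (deletion, ancestors, spinal bushes) a
  recursion over the tree. For \<open>s = u\<close> it would fail, as the parent of a child lies one
  level higher.\<close>

lemma parent_Node_deep:
  assumes "proper_tree (Node ts)" "u |\<in>| ts" "s \<in> subtrees u" "s \<noteq> u"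
  shows "parent (Node ts) s = parent u s"
proof -
  have "v \<in> subtrees (Node ts) \<and> s |\<in>| children v \<longleftrightarrow> v \<in> subtrees u \<and> s |\<in>| children v" for v
  proof
    assume v: "v \<in> subtrees (Node ts) \<and> s |\<in>| children v"
    have "v \<noteq> Node ts"
      using v assms subtrees_sibling_unique[of ts s u s] by auto
    then obtain w where w: "w |\<in>| ts" "v \<in> subtrees w" using v by auto
    then have "s \<in> subtrees w" using v children_subtrees subtrees_trans by blast
    then have "w = u" using subtrees_sibling_unique assms w by blast
    then show "v \<in> subtrees u \<and> s |\<in>| children v" using v w by simp
  qed (use assms in auto)
  then show ?thesis unfolding parent_def Bex_def by simp
qed

lemma parent_self: "proper_tree t \<Longrightarrow> parent t t = None"
  unfolding parent_def
  using leaves_children_psubset proper_tree_subtrees leaves_subtrees by fastforce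

lemma parent_SomeE:
  assumes "proper_tree t" "s \<in> subtrees t" "s \<noteq> t"
  obtains v where "parent t s = Some v" "v \<in> subtrees t" "s |\<in>| children v"
proof -
  have "\<exists>v\<in>subtrees t. parent t s = Some v \<and> s |\<in>| children v"
    using assms
  proof (induction t rule: proper_tree.induct)
    case (2 ts)
    then have ts: "proper_tree (Node ts)" by (intro proper_tree.intros) auto
    obtain u where u: "u |\<in>| ts" "s \<in> subtrees u" using 2 by auto
    show ?case
    proof (cases "s = u")
      case True
      then show ?thesis using u parent_Node_child[OF ts u(1)] by auto
    next
      case False
      then obtain v where "parent u s = Some v" "v \<in> subtrees u" "s |\<in>| children v"
        using 2 u by metis
      then show ?thesis using u parent_Node_deep[OF ts u False] by auto
    qed
  qed auto
  then show thesis using that by blast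
qed

lemma subst_notin: "s \<notin> subtrees t \<Longrightarrow> subst s r t = t"
  by (induction t) (auto intro!: fset_eqI simp: fimage.rep_eq image_iff)

text \<open>Whatever is done to a proper tree inside one child \<open>u\<close> appears on the whole
  tree as this exchange; all recursions below have this shape.\<close>

abbreviation repl :: "'a \<Rightarrow> 'a \<Rightarrow> 'a fset \<Rightarrow> 'a fset" where
  "repl u u' ts \<equiv> finsert u' (ts |-| {|u|})"

lemma fimage_eq_repl:
  assumes "u |\<in>| ts" "\<And>w. w |\<in>| ts \<Longrightarrow> w \<noteq> u \<Longrightarrow> f w = w"
  shows "f |`| ts = repl u (f u) ts"
  using assms by (intro fset_eqI) (auto simp: image_iff, metis+)

text \<open>Siblings share no subtrees, so the substitution fixes every child other than
  \<open>u\<close>.\<close>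

lemma subst_Node_deep:
  assumes "proper_tree (Node ts)" "u |\<in>| ts" "s \<in> subtrees u"
  shows "subst s r (Node ts) = Node (repl u (subst s r u) ts)"
proof -
  have "s \<noteq> Node ts" using assms Node_notin_subtrees_child by blast
  moreover have "subst s r |`| ts = repl u (subst s r u) ts"
    using assms subtrees_sibling_unique by (intro fimage_eq_repl) (blast intro: subst_notin)+
  ultimately show ?thesis by auto
qed

fun site_tree :: "'a site \<Rightarrow> 'a ltree" where
  "site_tree (Edge s) = s"
| "site_tree (Branch ts) = Node ts"

lemma ins_iff: "x \<in> ins t \<longleftrightarrow> site_tree x \<in> subtrees t"
  by (cases x) (auto simp: ins_def)

lemma finite_ins [simp]: "finite (ins t)"
proof -
  have "{ts. Node ts \<in> subtrees t} \<subseteq> children ` subtrees t" by force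
  then have "finite {ts. Node ts \<in> subtrees t}" by (rule finite_subset) simp
  then show ?thesis unfolding ins_def by (intro finite_UnI finite_imageI) simp_all
qed

text \<open>The replacement depends on the site alone and not on the surrounding tree, so that an
  insertion can be moved from a subtree to the tree.\<close>

lemma insert_leaf_eq_subst:
  "\<exists>s r. site_tree x = s \<and> (\<forall>t. insert_leaf j x t = subst s r t)"
  by (cases x) auto

lemma ins_Leaf: "ins (Leaf i) = {Edge (Leaf i)}"
  by (auto simp: ins_def)

lemma ins_Node: "ins (Node ts) = {Edge (Node ts), Branch ts} \<union> (\<Union>u\<in>fset ts. ins u)"
  by (auto simp: ins_def)

lemma insert_leaf_Edge_self: "insert_leaf j (Edge t) t = Node {|Leaf j, t|}"
  by (cases t) auto

lemma insert_leaf_Branch_self: "insert_leaf j (Branch ts) (Node ts) = Node (finsert (Leaf j) ts)"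
  by auto

lemma insert_leaf_deep:
  assumes "proper_tree (Node ts)" "u |\<in>| ts" "x \<in> ins u"
  shows "insert_leaf j x (Node ts) = Node (repl u (insert_leaf j x u) ts)"
  using insert_leaf_eq_subst[of x j] assms subst_Node_deep unfolding ins_iff by metis

lemma fcard_repl:
  assumes "u |\<in>| ts" "u' |\<notin>| ts |-| {|u|}"
  shows "fcard (repl u u' ts) = fcard ts"
proof -
  have "fcard (repl u u' ts) = Suc (fcard (ts |-| {|u|}))"
    using assms(2) by (rule fcard_finsert_disjoint)
  also have "\<dots> = fcard ts" using assms(1) card_Suc_Diff1[of "fset ts" u] by (simp add: fcard.rep_eq del: card_Diff_insert card_Diff_singleton)
  finally show ?thesis .
qed

text \<open>Children form a set: if the new child coincided with a sibling, the branch point would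
  silently lose a child. Disjoint nonempty label sets exclude this.\<close>

lemma notin_siblings:
  assumes "proper_tree (Node ts)" "u |\<in>| ts" "leaves u' \<noteq> {}"
    "leaves u' \<inter> (\<Union>w\<in>fset ts - {u}. leaves w) = {}"
  shows "u' |\<notin>| ts |-| {|u|}"
  using assms by auto

lemma proper_tree_repl:
  assumes "proper_tree (Node ts)" "u |\<in>| ts" "proper_tree u'"
    "leaves u' \<inter> (\<Union>w\<in>fset ts - {u}. leaves w) = {}"
  shows "proper_tree (Node (repl u u' ts))"
proof -
  have "fcard (repl u u' ts) = fcard ts"
    using fcard_repl notin_siblings assms leaves_nonempty by metis
  then show ?thesis
    using assms unfolding proper_tree_Node_iff disjoint_family_on_def by (auto simp: fcard.rep_eq) 
qed

lemma leaves_repl: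
  "leaves (Node (repl u u' ts)) = leaves u' \<union> (\<Union>w\<in>fset ts - {u}. leaves w)"
  by auto

lemma leaves_siblings:
  assumes "proper_tree (Node ts)" "u |\<in>| ts"
  shows "(\<Union>w\<in>fset ts - {u}. leaves w) = leaves (Node ts) - leaves u"
  using assms siblings_disjoint by fastforce

lemma proper_tree_Node_insert:
  assumes "proper_tree t" "j \<notin> leaves t"
  shows "proper_tree (Node {|Leaf j, t|})"
proof -
  have "t \<noteq> Leaf j" using assms(2) by auto
  then have "fcard {|Leaf j, t|} = 2" by (auto simp: fcard.rep_eq)
  then show ?thesis
    using assms by (auto simp: proper_tree_Node_iff disjoint_family_on_def intro: proper_tree.intros(1))
qed

lemma proper_tree_finsert_Leaf:
  assumes "proper_tree (Node ts)" "j \<notin> leaves (Node ts)"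
  shows "proper_tree (Node (finsert (Leaf j) ts))" "fcard (finsert (Leaf j) ts) = Suc (fcard ts)"
proof -
  have "Leaf j |\<notin>| ts" using assms by auto
  then show "fcard (finsert (Leaf j) ts) = Suc (fcard ts)" by (rule fcard_finsert_disjoint)
  then show "proper_tree (Node (finsert (Leaf j) ts))"
    using assms
    by (auto simp: proper_tree_Node_iff disjoint_family_on_def intro: proper_tree.intros(1))
qed

lemma proper_tree_insert_leaf:
  assumes "proper_tree t" "x \<in> ins t" "j \<notin> leaves t"
  shows "proper_tree (insert_leaf j x t) \<and> leaves (insert_leaf j x t) = insert j (leaves t)"
  using assms
proof (induction t rule: proper_tree.induct)
  case (1 l)
  then have "x = Edge (Leaf l)" by (simp add: ins_Leaf)
  then show ?case
    using proper_tree_Node_insert[OF proper_tree.intros(1), of j l] 1 by (simp add: insert_commute)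
next
  case (2 ts)
  then have ts: "proper_tree (Node ts)" by (intro proper_tree.intros) auto
  consider (edge) "x = Edge (Node ts)" | (branch) "x = Branch ts"
    | (child) u where "u |\<in>| ts" "x \<in> ins u"
    using "2.prems" by (auto simp: ins_Node)
  then show ?case
  proof cases
    case edge
    show ?thesis
      using proper_tree_Node_insert[OF ts "2.prems"(2)]
      unfolding edge insert_leaf_Edge_self by simp
  next
    case branch
    show ?thesis
      using proper_tree_finsert_Leaf[OF ts "2.prems"(2)]
      unfolding branch insert_leaf_Branch_self by simp
  next
    case child
    have u: "j \<notin> leaves u" using "2.prems" child by auto
    then have IH: "proper_tree (insert_leaf j x u)" "leaves (insert_leaf j x u) = insert j (leaves u)"
      using "2.IH" child by auto
    have "leaves (insert_leaf j x u) \<inter> (\<Union>w\<in>fset ts - {u}. leaves w) = {}"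
      unfolding leaves_siblings[OF ts child(1)] IH using "2.prems" by blast
    then have "proper_tree (Node (repl u (insert_leaf j x u) ts))"
      by (intro proper_tree_repl[OF ts child(1)] IH)
    moreover have "leaves (Node (repl u (insert_leaf j x u) ts)) = insert j (leaves (Node ts))"
      using child(1) unfolding leaves_repl IH by auto
    ultimately show ?thesis unfolding insert_leaf_deep[OF ts child] by (rule conjI)
  qed
qed

text \<open>Keeps \<open>proper_tree (Node ts)\<close> as a single hypothesis of the induction step,
  where the rule of the inductive predicate supplies only its parts.\<close>

lemma proper_tree_induct [consumes 1, case_names Leaf Node]:
  assumes "proper_tree t" "\<And>i. P (Leaf i)"
    "\<And>ts. proper_tree (Node ts) \<Longrightarrow> (\<And>u. u |\<in>| ts \<Longrightarrow> P u) \<Longrightarrow> P (Node ts)"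
  shows "P t"
  using assms(1)
proof (induction rule: proper_tree.induct)
  case (2 ts)
  then have "proper_tree (Node ts)" by (intro proper_tree.intros) auto
  then show ?case using 2 assms(3) by blast
qed (fact assms(2))

section \<open>Weighted sums over insertion sites\<close>

text \<open>The growth step without its normalising factor. Sums of weights decompose along
  subtrees, and nothing is divided by \<open>n - \<alpha>\<close>, which is 0 for one leaf and
  \<alpha> = 1.\<close>

definition ins_sum ::
  "real \<Rightarrow> real \<Rightarrow> 'a \<Rightarrow> 'a ltree \<Rightarrow> ('a ltree \<Rightarrow> real) \<Rightarrow> real" where
  "ins_sum \<alpha> \<gamma> j t g = (\<Sum>x\<in>ins t. weight \<alpha> \<gamma> x * g (insert_leaf j x t))"

lemma ins_sum_Leaf: "ins_sum \<alpha> \<gamma> j (Leaf i) g = (1 - \<alpha>) * g (Node {|Leaf j, Leaf i|})"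
  by (simp add: ins_sum_def ins_Leaf)

text \<open>The recursion behind the later inductions: a child \<open>u\<close> receives
  \<open>g\<close> composed with the map that puts the altered child back among its
  siblings.\<close>

lemma ins_sum_Node:
  assumes "proper_tree (Node ts)"
  shows "ins_sum \<alpha> \<gamma> j (Node ts) g =
    \<gamma> * g (Node {|Leaf j, Node ts|}) +
    ((real (fcard ts) - 1) * \<alpha> - \<gamma>) * g (Node (finsert (Leaf j) ts)) +
    (\<Sum>u\<in>fset ts. ins_sum \<alpha> \<gamma> j u (\<lambda>u'. g (Node (repl u u' ts))))"
proof -
  define h where "h x = weight \<alpha> \<gamma> x * g (insert_leaf j x (Node ts))" for x
  have notin: "Edge (Node ts) \<notin> (\<Union>u\<in>fset ts. ins u)" "Branch ts \<notin> (\<Union>u\<in>fset ts. ins u)"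
    using Node_notin_subtrees_child[OF assms] by (auto simp: ins_iff)
  have "ins_sum \<alpha> \<gamma> j (Node ts) g = sum h ({Edge (Node ts), Branch ts} \<union> (\<Union>u\<in>fset ts. ins u))"
    unfolding ins_sum_def h_def ins_Node ..
  also have "\<dots> = h (Edge (Node ts)) + h (Branch ts) + sum h (\<Union>u\<in>fset ts. ins u)"
    using notin by simp
  also have "sum h (\<Union>u\<in>fset ts. ins u) = (\<Sum>u\<in>fset ts. sum h (ins u))"
    using subtrees_sibling_unique[OF assms]
    by (intro sum.UNION_disjoint) (auto simp: ins_iff)
  also have "(\<Sum>u\<in>fset ts. sum h (ins u))
      = (\<Sum>u\<in>fset ts. ins_sum \<alpha> \<gamma> j u (\<lambda>u'. g (Node (repl u u' ts))))"
    unfolding ins_sum_def h_def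
    by (intro sum.cong refl) (simp add: insert_leaf_deep[OF assms])
  finally show ?thesis by (simp add: h_def)
qed

lemma ins_sum_cong:
  assumes "proper_tree t" "j \<notin> leaves t"
    "\<And>t'. proper_tree t' \<Longrightarrow> leaves t' = insert j (leaves t) \<Longrightarrow> g t' = g' t'"
  shows "ins_sum \<alpha> \<gamma> j t g = ins_sum \<alpha> \<gamma> j t g'"
  unfolding ins_sum_def
  by (intro sum.cong refl) (simp add: assms proper_tree_insert_leaf)

lemma ins_sum_const: "ins_sum \<alpha> \<gamma> j t (\<lambda>t'. c) = ins_sum \<alpha> \<gamma> j t (\<lambda>_. 1) * c"
  by (simp add: ins_sum_def sum_distrib_right)

lemma ins_sum_sum:
  "ins_sum \<alpha> \<gamma> j t (\<lambda>t'. \<Sum>i\<in>I. g i t') = (\<Sum>i\<in>I. ins_sum \<alpha> \<gamma> j t (g i))"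
  unfolding ins_sum_def by (subst sum.swap) (simp add: sum_distrib_left)

lemma card_leaves_Node:
  "proper_tree (Node ts) \<Longrightarrow> card (leaves (Node ts)) = (\<Sum>u\<in>fset ts. card (leaves u))"
  by (simp, intro card_UN_disjoint) (auto dest: siblings_disjoint)

text \<open>With \<open>c\<close> children, the top edge and the branch point together weigh
  \<open>(c - 1) * \<alpha>\<close>; the children contribute their numbers of leaves minus
  \<open>c * \<alpha>\<close>.\<close>

lemma ins_sum_total:
  "proper_tree t \<Longrightarrow> ins_sum \<alpha> \<gamma> j t (\<lambda>_. 1) = real (card (leaves t)) - \<alpha>"
proof (induction t rule: proper_tree_induct)
  case (Node ts)
  have "(\<Sum>u\<in>fset ts. ins_sum \<alpha> \<gamma> j u (\<lambda>_. 1)) = (\<Sum>u\<in>fset ts. real (card (leaves u)) - \<alpha>)"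
    using Node.IH by (intro sum.cong) auto
  then show ?case
    unfolding ins_sum_Node[OF Node.hyps] card_leaves_Node[OF Node.hyps]
    by (simp add: sum_subtractf fcard.rep_eq algebra_simps)
qed (simp add: ins_sum_Leaf)

section \<open>Deletion\<close>

lemma subst_self [simp]: "subst s r s = r"
  by (cases s) auto

lemma delete_leaf_child:
  assumes "proper_tree (Node ts)" "Leaf i |\<in>| ts"
  shows "delete_leaf i (Node ts) =
    (if fcard ts = 2 then fthe_elem (ts |-| {|Leaf i|}) else Node (ts |-| {|Leaf i|}))"
  unfolding delete_leaf_def parent_Node_child[OF assms] option.sel Let_def ltree.sel subst_self ..

lemma delete_leaf_pair:
  assumes "proper_tree (Node {|Leaf i, u|})" "u \<noteq> Leaf i"
  shows "delete_leaf i (Node {|Leaf i, u|}) = u"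
proof -
  have "fcard {|Leaf i, u|} = 2" using assms(2) by (auto simp: fcard.rep_eq)
  moreover have "{|Leaf i, u|} |-| {|Leaf i|} = {|u|}" using assms(2) by auto
  ultimately show ?thesis
    using delete_leaf_child[OF assms(1), of i]
    by (simp add: fthe_elem.rep_eq del: minus_fset.rep_eq finsert_fminus_single)
qed

text \<open>Since \<open>u\<close> is not the leaf itself, the parent of \<open>i\<close> lies
  inside \<open>u\<close>, and so does a possible suppression of that parent.\<close>

lemma delete_leaf_deep:
  assumes "proper_tree (Node ts)" "u |\<in>| ts" "i \<in> leaves u" "u \<noteq> Leaf i"
  shows "delete_leaf i (Node ts) = Node (repl u (delete_leaf i u) ts)"
proof -
  obtain v where v: "parent u (Leaf i) = Some v" "v \<in> subtrees u"
    using parent_SomeE[of u "Leaf i"] proper_tree_child[OF assms(1,2)] assms by auto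
  have "parent (Node ts) (Leaf i) = Some v"
    using parent_Node_deep[OF assms(1,2)] v assms by auto
  then show ?thesis
    unfolding delete_leaf_def v(1) Let_def using subst_Node_deep[OF assms(1,2) v(2)] by simp
qed

text \<open>The case split of the inductions over the position of a leaf: either it hangs at the
  root branch point, where something is computed, or the induction hypothesis for the child
  containing it applies.\<close>

lemma leaf_location_cases:
  assumes "i \<in> leaves (Node ts)"
  obtains (child) "Leaf i |\<in>| ts" | (deep) u where "u |\<in>| ts" "i \<in> leaves u" "u \<noteq> Leaf i"
  using assms by fastforce

lemma fcard_2_obtain:
  assumes "fcard ts = 2" "u |\<in>| ts"
  obtains w where "ts = {|u, w|}" "w \<noteq> u" 
proof -
  obtain x y where "fset ts = {x, y}" "x \<noteq> y"
    using assms(1) by (auto simp: fcard.rep_eq card_2_iff)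
  then have "ts = {|x, y|}" by (intro fset_eqI) auto
  then show ?thesis using that[of x] that[of y] assms(2) \<open>x \<noteq> y\<close>
    by (auto simp: finsert_commute)
qed

lemma proper_tree_delete_leaf:
  assumes "proper_tree t" "i \<in> leaves t" "t \<noteq> Leaf i"
  shows "proper_tree (delete_leaf i t) \<and> leaves (delete_leaf i t) = leaves t - {i}"
  using assms
proof (induction t rule: proper_tree_induct)
  case (Node ts)
  from Node.prems(1) show ?case
  proof (cases rule: leaf_location_cases)
    case child
    show ?thesis
    proof (cases "fcard ts = 2")
      case True
      then obtain w where w: "ts = {|Leaf i, w|}" "w \<noteq> Leaf i" by (rule fcard_2_obtain[OF _ child])
      then show ?thesis
        using delete_leaf_pair[of i w] Node.hyps siblings_disjoint[OF Node.hyps, of "Leaf i" w]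
          proper_tree_child[OF Node.hyps, of w]
        by auto
    next
      case False
      have c: "fcard (ts |-| {|Leaf i|}) = fcard ts - 1"
        using child by (simp add: fcard.rep_eq)
      have "proper_tree (Node (ts |-| {|Leaf i|}))"
        using Node.hyps False c
        unfolding proper_tree_Node_iff disjoint_family_on_def by auto
      moreover have "leaves (Node (ts |-| {|Leaf i|})) = leaves (Node ts) - {i}"
        using leaves_siblings[OF Node.hyps child] by simp
      ultimately show ?thesis
        using delete_leaf_child[OF Node.hyps child] False by simp
    qed
  next
    case (deep u)
    then have IH: "proper_tree (delete_leaf i u)" "leaves (delete_leaf i u) = leaves u - {i}"
      using Node.IH by auto
    have s: "(\<Union>w\<in>fset ts - {u}. leaves w) = leaves (Node ts) - leaves u"
      using leaves_siblings[OF Node.hyps deep(1)] .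
    have "proper_tree (Node (repl u (delete_leaf i u) ts))"
      by (intro proper_tree_repl[OF Node.hyps deep(1)] IH) (unfold s IH, blast)
    moreover have "leaves (Node (repl u (delete_leaf i u) ts)) = leaves (Node ts) - {i}"
      using deep unfolding leaves_repl s IH by auto
    ultimately show ?thesis
      unfolding delete_leaf_deep[OF Node.hyps deep] by (rule conjI)
  qed
qed auto

section \<open>Relabelling\<close>

text \<open>A sibling is determined by its nonempty label set, so an injective relabelling cannot
  merge two children.\<close>

lemma inj_on_map_siblings:
  assumes "proper_tree (Node ts)" "inj_on \<sigma> (leaves (Node ts))"
  shows "inj_on (map_ltree \<sigma>) (fset ts)"
proof (rule inj_onI)
  fix u w assume uw: "u \<in> fset ts" "w \<in> fset ts" and eq: "map_ltree \<sigma> u = map_ltree \<sigma> w"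
  have "\<sigma> ` leaves u = \<sigma> ` leaves w" using arg_cong[OF eq, of leaves] by (simp add: ltree.set_map)
  then have "leaves u = leaves w"
    using inj_on_image_eq_iff[OF assms(2), of "leaves u" "leaves w"] uw by auto
  moreover have "leaves u \<noteq> {}" using leaves_nonempty proper_tree_child[OF assms(1)] uw by blast
  ultimately show "u = w" using siblings_disjoint[OF assms(1)] uw by blast
qed

lemma fimage_fminus_singleton:
  assumes "inj_on f (fset ts)" "u |\<in>| ts"
  shows "f |`| (ts |-| {|u|}) = f |`| ts |-| {|f u|}"
proof -
  have "f ` (fset ts - {u}) = f ` fset ts - f ` {u}"
    by (rule inj_on_image_set_diff[OF assms(1)]) (use assms(2) in auto)
  then show ?thesis by (simp add: fset_inject[symmetric])
qed

lemma fimage_repl: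
  assumes "inj_on f (fset ts)" "u |\<in>| ts"
  shows "f |`| repl u u' ts = repl (f u) (f u') (f |`| ts)"
  using fimage_fminus_singleton[OF assms] by simp

lemma fcard_fimage_inj: "inj_on f (fset ts) \<Longrightarrow> fcard (f |`| ts) = fcard ts"
  by (simp add: fcard.rep_eq card_image)

lemma proper_tree_map:
  assumes "proper_tree t" "inj_on \<sigma> (leaves t)"
  shows "proper_tree (map_ltree \<sigma> t)"
  using assms
proof (induction t rule: proper_tree_induct)
  case (Node ts)
  have "proper_tree (map_ltree \<sigma> u)" if "u |\<in>| ts" for u
    using Node that by (meson inj_on_subset leaves_child_psubset psubsetE)
  moreover have "disjoint_family_on leaves (map_ltree \<sigma> ` fset ts)"
    unfolding disjoint_family_on_def
  proof (intro ballI impI, elim imageE)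
    fix x y u w assume *: "x \<noteq> y" "x = map_ltree \<sigma> u" "u \<in> fset ts" "y = map_ltree \<sigma> w" "w \<in> fset ts"
    then have "leaves u \<inter> leaves w = {}" using siblings_disjoint[OF Node.hyps, of u w] by auto
    moreover have "leaves u \<subseteq> leaves (Node ts)" "leaves w \<subseteq> leaves (Node ts)" using * by auto
    ultimately show "leaves x \<inter> leaves y = {}"
      using inj_on_image_Int[OF Node.prems, of "leaves u" "leaves w"] * by (simp add: ltree.set_map)
  qed
  ultimately show ?case
    using Node.hyps fcard_fimage_inj[OF inj_on_map_siblings[OF Node.hyps Node.prems]]
    by (auto simp: proper_tree_Node_iff)
qed (auto intro: proper_tree.intros)

lemma map_ltree_eq_Leaf_iff: "map_ltree \<sigma> t = Leaf k \<longleftrightarrow> (\<exists>i. t = Leaf i \<and> k = \<sigma> i)"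
  by (cases t) auto

lemma delete_leaf_map:
  assumes "proper_tree t" "i \<in> leaves t" "t \<noteq> Leaf i" "inj_on \<sigma> (leaves t)"
  shows "delete_leaf (\<sigma> i) (map_ltree \<sigma> t) = map_ltree \<sigma> (delete_leaf i t)"
  using assms
proof (induction t rule: proper_tree_induct)
  case (Node ts)
  let ?f = "map_ltree \<sigma>"
  have inj: "inj_on ?f (fset ts)" by (rule inj_on_map_siblings[OF Node.hyps Node.prems(3)])
  have p: "proper_tree (Node (?f |`| ts))"
    using proper_tree_map[OF Node.hyps Node.prems(3)] by simp
  from Node.prems(1) show ?case
  proof (cases rule: leaf_location_cases)
    case child
    then have child': "Leaf (\<sigma> i) |\<in>| ?f |`| ts" by force
    have "?f |`| (ts |-| {|Leaf i|}) = ?f |`| ts |-| {|Leaf (\<sigma> i)|}"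
      using fimage_fminus_singleton[OF inj child] by simp
    moreover have "fthe_elem (?f |`| (ts |-| {|Leaf i|})) = ?f (fthe_elem (ts |-| {|Leaf i|}))"
      if "fcard ts = 2"
    proof -
      obtain w where w: "ts = {|Leaf i, w|}" "w \<noteq> Leaf i" by (rule fcard_2_obtain[OF \<open>fcard ts = 2\<close> child])
      then have "ts |-| {|Leaf i|} = {|w|}" by auto
      then show ?thesis by (simp add: fthe_elem.rep_eq)
    qed
    ultimately show ?thesis
      using delete_leaf_child[OF Node.hyps child] delete_leaf_child[OF p child']
      by (auto simp: fcard_fimage_inj[OF inj])
  next
    case (deep u)
    have "inj_on \<sigma> (leaves u)" using Node.prems(3) deep(1) by (auto intro: inj_on_subset)
    then have IH: "delete_leaf (\<sigma> i) (?f u) = ?f (delete_leaf i u)" using Node.IH deep by auto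
    have "i = k" if "u = Leaf k" "\<sigma> i = \<sigma> k" for k using that deep by auto
    then have "?f u \<noteq> Leaf (\<sigma> i)" using deep by (auto simp: map_ltree_eq_Leaf_iff)
    then have "delete_leaf (\<sigma> i) (Node (?f |`| ts)) = Node (repl (?f u) (?f (delete_leaf i u)) (?f |`| ts))"
      using delete_leaf_deep[OF p, of "?f u" "\<sigma> i"] deep IH by (auto simp: ltree.set_map)
    then show ?thesis
      using fimage_repl[OF inj deep(1)] delete_leaf_deep[OF Node.hyps deep] by simp
  qed
qed auto

text \<open>Relabelling preserves the kind of a site and the number of children, hence all weights.
  The inserted label is renamed as well, which later turns an insertion of \<open>n\<close> into a
  label set with a gap into a genuine growth step.\<close>

lemma ins_sum_map:
  assumes "proper_tree t" "j \<notin> leaves t" "inj_on \<sigma> (insert j (leaves t))"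
  shows "ins_sum \<alpha> \<gamma> j t (\<lambda>t'. g (map_ltree \<sigma> t')) = ins_sum \<alpha> \<gamma> (\<sigma> j) (map_ltree \<sigma> t) g"
  using assms
proof (induction t arbitrary: g rule: proper_tree_induct)
  case (Node ts)
  let ?f = "map_ltree \<sigma>"
  have inj': "inj_on \<sigma> (leaves (Node ts))" using Node.prems(2) by (rule inj_on_subset) auto
  have inj: "inj_on ?f (fset ts)" by (rule inj_on_map_siblings[OF Node.hyps inj'])
  have p: "proper_tree (Node (?f |`| ts))"
    using proper_tree_map[OF Node.hyps inj'] by simp
  have "ins_sum \<alpha> \<gamma> j u (\<lambda>u'. g (?f (Node (repl u u' ts)))) =
      ins_sum \<alpha> \<gamma> (\<sigma> j) (?f u) (\<lambda>u'. g (Node (repl (?f u) u' (?f |`| ts))))" if u: "u \<in> fset ts" for u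
  proof -
    have j: "j \<notin> leaves u" "inj_on \<sigma> (insert j (leaves u))"
      using Node.prems u by (auto intro: inj_on_subset)
    show ?thesis
      using Node.IH[OF u j, of "\<lambda>u'. g (Node (repl (?f u) u' (?f |`| ts)))"] fimage_repl[OF inj u]
      by (simp only: ltree.map)
  qed
  then show ?case
    by (simp add: ins_sum_Node[OF Node.hyps] ins_sum_Node[OF p] fcard_fimage_inj[OF inj]
        sum.reindex[OF inj] del: finsert_fminus_single)
qed (simp add: ins_sum_Leaf)

section \<open>Finitely supported laws\<close>

lemma
  fixes f :: "'a \<Rightarrow> real"
  assumes "finite A" "\<And>x. 0 \<le> f x" "\<And>x. x \<notin> A \<Longrightarrow> f x = 0" "sum f A = 1"
  shows set_embed_pmf_finite: "set_pmf (embed_pmf f) \<subseteq> A"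
    and expectation_embed_pmf_finite:
      "measure_pmf.expectation (embed_pmf f) F = (\<Sum>x\<in>A. f x * F x)"
proof -
  have "(\<integral>\<^sup>+x. ennreal (f x) \<partial>count_space UNIV) = (\<Sum>x\<in>A. ennreal (f x))"
    using assms by (intro nn_integral_count_space') auto
  then have *: "(\<integral>\<^sup>+x. ennreal (f x) \<partial>count_space UNIV) = 1"
    using assms by simp
  have **: "pmf (embed_pmf f) x = f x" for x
    by (rule pmf_embed_pmf[OF assms(2) *])
  show "set_pmf (embed_pmf f) \<subseteq> A"
    using assms(3) by (auto simp: set_pmf_eq **)
  then show "measure_pmf.expectation (embed_pmf f) F = (\<Sum>x\<in>A. f x * F x)"
    using assms(1) by (subst integral_measure_pmf[of A]) (auto simp: **)
qed

section \<open>The law of the swapped label\<close>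

text \<open>The numerators of \<open>swap_frac\<close> without the bound \<open>j' \<le> c\<close>.
  They do not depend on \<open>c\<close>, which makes the swap probabilities before and after adding
  a child comparable.\<close>

definition swap_num :: "real \<Rightarrow> real \<Rightarrow> nat \<Rightarrow> nat \<Rightarrow> real" where
  "swap_num \<alpha> \<gamma> j j' =
     (if j \<le> 2 \<and> j' = 3 then \<alpha> - \<gamma>
      else if j \<le> 2 \<and> 3 < j' then \<alpha>
      else if 2 < j \<and> j < j' then \<alpha>
      else if 2 < j \<and> j = j' then (real j - 2) * \<alpha> - \<gamma>
      else 0)"

text \<open>Passing from \<open>c\<close> to \<open>c + 1\<close> adds the numerator \<alpha> if the
  position \<open>j\<close> is an old one; if \<open>j = c + 1\<close>, the earlier numerators
  vanish and the diagonal one is the whole sum.\<close>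

lemma sum_swap_num:
  assumes "3 \<le> c" "1 \<le> j" "j \<le> c"
  shows "(\<Sum>k=1..c. swap_num \<alpha> \<gamma> j k) = (real c - 2) * \<alpha> - \<gamma>"
  using assms
proof (induction rule: dec_induct)
  case base
  have "j = 1 \<or> j = 2 \<or> j = 3" using base by linarith
  moreover have "{1..3} = {1, 2, 3::nat}" by auto
  ultimately show ?case by (auto simp: swap_num_def)
next
  case (step c)
  show ?case
  proof (cases "j = Suc c")
    case True
    have "(\<Sum>k=1..c. swap_num \<alpha> \<gamma> j k) = 0"
      using True step by (intro sum.neutral) (auto simp: swap_num_def)
    then show ?thesis using True step by (simp add: swap_num_def)
  next
    case False
    then have "swap_num \<alpha> \<gamma> j (Suc c) = \<alpha>" using step by (auto simp: swap_num_def)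
    moreover have "(\<Sum>k=1..c. swap_num \<alpha> \<gamma> j k) = (real c - 2) * \<alpha> - \<gamma>"
      using False step by simp
    ultimately show ?thesis by (simp add: algebra_simps)
  qed
qed

lemma swap_frac_eq_num:
  assumes "3 \<le> c" "1 \<le> j" "j \<le> c"
  shows "swap_frac \<alpha> \<gamma> c j j' =
    (if j' \<le> c then swap_num \<alpha> \<gamma> j j' / ((real c - 2) * \<alpha> - \<gamma>) else 0)"
  using assms unfolding swap_frac_def swap_num_def Let_def by auto

lemma swap_prob_limit:
  assumes "4 \<le> c" "1 \<le> j" "j \<le> c"
  shows "swap_prob 0 0 c j j' = swap_frac 1 1 c j j'"
proof -
  have "swap_frac a a c j j' = swap_frac 1 1 c j j'" if "a > 0" for a
  proof -
    have "(real k - 2) * a - a = (real k - 3) * a" for k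
      by (simp add: algebra_simps)
    then show ?thesis using that assms unfolding swap_frac_def Let_def by simp
  qed
  then have "\<forall>\<^sub>F a in at_right 0. swap_frac a a c j j' = swap_frac 1 1 c j j'"
    using eventually_at_right_less[of "0::real"] by (rule eventually_mono[rotated])
  then have "((\<lambda>a. swap_frac a a c j j') \<longlongrightarrow> swap_frac 1 1 c j j') (at_right 0)"
    by (rule tendsto_eventually)
  then have "Lim (at_right 0) (\<lambda>a. swap_frac a a c j j') = swap_frac 1 1 c j j'"
    by (intro tendsto_Lim) auto
  then show ?thesis using assms by (simp add: swap_prob_def)
qed

text \<open>The limiting case \<open>\<alpha> = \<gamma> = 0\<close> agrees with \<open>\<alpha> = \<gamma> = 1\<close>, as the fractions are homogeneous.\<close>

lemma swap_prob_ge_4: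
  assumes "0 \<le> \<gamma>" "\<gamma> \<le> \<alpha>" "4 \<le> c" "1 \<le> j" "j \<le> c"
  obtains \<alpha>' \<gamma>' where "0 < \<alpha>'" "0 \<le> \<gamma>'" "\<gamma>' \<le> \<alpha>'" "(real c - 2) * \<alpha>' - \<gamma>' > 0"
    "\<And>j'. swap_prob \<alpha> \<gamma> c j j' =
       (if j' \<le> c then swap_num \<alpha>' \<gamma>' j j' / ((real c - 2) * \<alpha>' - \<gamma>') else 0)"
    "0 < \<alpha> \<Longrightarrow> \<alpha>' = \<alpha> \<and> \<gamma>' = \<gamma>"
proof -
  have pos: "(real c - 2) * a - g > 0" if "0 < a" "g \<le> a" for a g
  proof -
    have "(real c - 2) * a \<ge> 2 * a" using that assms by (intro mult_right_mono) auto
    then show ?thesis using that by linarith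
  qed
  show thesis
  proof (cases "\<alpha> = 0")
    case True
    then have "\<gamma> = 0" using assms by simp
    then show ?thesis
      using True assms swap_prob_limit[of c j] swap_frac_eq_num[of c j 1 1] pos[of 1 1]
      by (intro that[of 1 1]) auto
  next
    case False
    then show ?thesis
      using assms swap_frac_eq_num[of c j \<alpha> \<gamma>] pos[of \<alpha> \<gamma>]
      by (intro that[of \<alpha> \<gamma>]) (auto simp: swap_prob_def)
  qed
qed

lemma swap_num_nonneg: "0 \<le> \<gamma> \<Longrightarrow> \<gamma> \<le> \<alpha> \<Longrightarrow> 0 \<le> swap_num \<alpha> \<gamma> j j'"
proof -
  assume *: "0 \<le> \<gamma>" "\<gamma> \<le> \<alpha>"
  have "(real j - 2) * \<alpha> \<ge> 1 * \<alpha>" if "2 < j" using that * by (intro mult_right_mono) auto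
  then show ?thesis using * unfolding swap_num_def by auto
qed

context
  fixes \<alpha> \<gamma> :: real and c j :: nat
  assumes params: "0 \<le> \<gamma>" "\<gamma> \<le> \<alpha>" and c: "3 \<le> c" "1 \<le> j" "j \<le> c"
begin

lemma swap_prob_nonneg: "0 \<le> swap_prob \<alpha> \<gamma> c j k"
proof (cases "c = 3")
  case False
  then have "4 \<le> c" using c by simp
  then show ?thesis
    using swap_prob_ge_4[OF params _ c(2,3)] swap_num_nonneg by (metis divide_nonneg_pos order_refl)
qed (simp add: swap_prob_def)

lemma swap_prob_eq_0: "k \<notin> {1..c} \<Longrightarrow> swap_prob \<alpha> \<gamma> c j k = 0"
proof (cases "c = 3")
  case False
  assume k: "k \<notin> {1..c}"
  have 4: "4 \<le> c" using False c by simp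
  obtain \<alpha>' \<gamma>' where "\<And>j'. swap_prob \<alpha> \<gamma> c j j' =
       (if j' \<le> c then swap_num \<alpha>' \<gamma>' j j' / ((real c - 2) * \<alpha>' - \<gamma>') else 0)"
    using swap_prob_ge_4[OF params 4 c(2,3)] by metis
  then show ?thesis using k c by (auto simp: swap_num_def)
qed (auto simp: swap_prob_def)

lemma sum_swap_prob: "(\<Sum>k=1..c. swap_prob \<alpha> \<gamma> c j k) = 1"
proof (cases "c = 3")
  case False
  have 4: "4 \<le> c" using False c by simp
  obtain \<alpha>' \<gamma>' where *: "(real c - 2) * \<alpha>' - \<gamma>' > 0" "\<And>j'. swap_prob \<alpha> \<gamma> c j j' =
       (if j' \<le> c then swap_num \<alpha>' \<gamma>' j j' / ((real c - 2) * \<alpha>' - \<gamma>') else 0)"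
    using swap_prob_ge_4[OF params 4 c(2,3)] by metis
  have "(\<Sum>k=1..c. swap_prob \<alpha> \<gamma> c j k)
      = (\<Sum>k=1..c. swap_num \<alpha>' \<gamma>' j k) / ((real c - 2) * \<alpha>' - \<gamma>')"
    unfolding sum_divide_distrib by (intro sum.cong) (auto simp: *)
  then show ?thesis using * sum_swap_num[OF c] by simp
qed (simp add: swap_prob_def)

text \<open>Cleared of the denominator, all readings of the fractions agree: for
  \<open>c = 3\<close> the only nonzero numerator is \<alpha> - \<gamma>, and for \<alpha> = 0 both
  sides vanish. The factor on the left is the weight of a branch point with \<open>c - 1\<close>
  children, which is how the swap rule meets the growth rule.\<close>

lemma weight_mult_swap_prob:
  assumes "1 \<le> k" "k \<le> c"
  shows "((real c - 2) * \<alpha> - \<gamma>) * swap_prob \<alpha> \<gamma> c j k = swap_num \<alpha> \<gamma> j k"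
proof (cases "c = 3")
  case True
  then show ?thesis using assms c by (auto simp: swap_prob_def swap_num_def)
next
  case False
  have 4: "4 \<le> c" using False c by simp
  obtain \<alpha>' \<gamma>' where *: "(real c - 2) * \<alpha>' - \<gamma>' > 0" "\<And>j'. swap_prob \<alpha> \<gamma> c j j' =
       (if j' \<le> c then swap_num \<alpha>' \<gamma>' j j' / ((real c - 2) * \<alpha>' - \<gamma>') else 0)"
       "0 < \<alpha> \<Longrightarrow> \<alpha>' = \<alpha> \<and> \<gamma>' = \<gamma>"
    using swap_prob_ge_4[OF params 4 c(2,3)] by metis
  show ?thesis
  proof (cases "\<alpha> = 0")
    case True
    then show ?thesis using params by (simp add: swap_num_def)
  next
    case False
    then show ?thesis using * params assms by simp
  qed
qed

end

text \<open>At the last position the diagonal numerator \<open>(c - 2) * \<alpha> - \<gamma>\<close>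
  equals the denominator, so a selected leaf with the largest least label keeps it.\<close>

lemma swap_prob_last:
  assumes "0 \<le> \<gamma>" "\<gamma> \<le> \<alpha>" "3 \<le> c" "1 \<le> k" "k < c"
  shows "swap_prob \<alpha> \<gamma> c c k = 0"
proof (cases "c = 3")
  case False
  have 4: "4 \<le> c" using False assms by simp
  obtain \<alpha>' \<gamma>' where "\<And>j'. swap_prob \<alpha> \<gamma> c c j' =
       (if j' \<le> c then swap_num \<alpha>' \<gamma>' c j' / ((real c - 2) * \<alpha>' - \<gamma>') else 0)"
    using swap_prob_ge_4[OF assms(1,2) 4, of c] assms by (metis le_refl le_trans numeral_One one_le_numeral)
  then show ?thesis using assms by (auto simp: swap_num_def)
qed (use assms in \<open>simp add: swap_prob_def\<close>)

definition least_labels :: "nat ltree fset \<Rightarrow> nat list" where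
  "least_labels ts = sorted_list_of_set ((\<lambda>u. least_label {u}) ` fset ts)"

text \<open>The law of the swapped label in terms of the siblings \<open>ts\<close> of the selected leaf \<open>i\<close> (\<open>i\<close>
  included) and of the least label \<open>b\<close> in the second spinal bush.\<close>

definition local_swap ::
  "real \<Rightarrow> real \<Rightarrow> nat ltree fset \<Rightarrow> nat \<Rightarrow> nat \<Rightarrow> nat pmf" where
  "local_swap \<alpha> \<gamma> ts b i =
    (if fcard ts = 2 then return_pmf (Max {i, least_label (fset ts - {Leaf i}), b})
     else map_pmf (\<lambda>k. least_labels ts ! (k - 1)) (embed_pmf (swap_prob \<alpha> \<gamma> (fcard ts)
       (THE k. k \<in> {1..fcard ts} \<and> least_labels ts ! (k - 1) = i))))"

lemma least_label_singleton: "least_label {u} = Min (leaves u)"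
  by (simp add: least_label_def)

lemma least_label_in: "proper_tree u \<Longrightarrow> least_label {u} \<in> leaves u"
  by (simp add: least_label_singleton leaves_nonempty)

lemma inj_on_least_label:
  assumes "proper_tree (Node ts)"
  shows "inj_on (\<lambda>u. least_label {u}) (fset ts)"
proof (rule inj_onI)
  fix u w assume *: "u \<in> fset ts" "w \<in> fset ts" "least_label {u} = least_label {w}"
  then show "u = w"
    using least_label_in proper_tree_child[OF assms] sibling_unique[OF assms, of u w] by metis
qed

lemma length_least_labels: "proper_tree (Node ts) \<Longrightarrow> length (least_labels ts) = fcard ts"
  unfolding least_labels_def
  by (simp add: card_image inj_on_least_label fcard.rep_eq)

lemma set_least_labels: "set (least_labels ts) = (\<lambda>u. least_label {u}) ` fset ts"
  by (simp add: least_labels_def)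

lemma least_labels_subset: "proper_tree (Node ts) \<Longrightarrow> set (least_labels ts) \<subseteq> leaves (Node ts)"
  using least_label_in proper_tree_child unfolding set_least_labels by fastforce

lemma least_labels_position:
  assumes "proper_tree (Node ts)" "Leaf i |\<in>| ts"
  obtains j where "1 \<le> j" "j \<le> fcard ts" "least_labels ts ! (j - 1) = i"
proof -
  have "i = least_label {Leaf i}" by (simp add: least_label_singleton)
  then have "i \<in> set (least_labels ts)" using assms(2) unfolding set_least_labels by (metis imageI)
  then obtain k where "k < length (least_labels ts)" "least_labels ts ! k = i"
    by (metis in_set_conv_nth)
  then show thesis using that[of "Suc k"] length_least_labels[OF assms(1)] by simp
qed

context
  fixes \<alpha> \<gamma> :: real and ts :: "nat ltree fset" and i j :: nat
  assumes params: "0 \<le> \<gamma>" "\<gamma> \<le> \<alpha>" and ts: "proper_tree (Node ts)" "fcard ts \<noteq> 2"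
    and j: "1 \<le> j" "j \<le> fcard ts" "least_labels ts ! (j - 1) = i"
begin

lemma fcard_ge_3: "3 \<le> fcard ts"
  using ts by (auto simp: proper_tree_Node_iff)

lemma local_swap_eq:
  "local_swap \<alpha> \<gamma> ts b i =
     map_pmf (\<lambda>k. least_labels ts ! (k - 1)) (embed_pmf (swap_prob \<alpha> \<gamma> (fcard ts) j))"
proof -
  have "distinct (least_labels ts)" by (simp add: least_labels_def)
  then have "(THE k. k \<in> {1..fcard ts} \<and> least_labels ts ! (k - 1) = i) = j"
    using j length_least_labels[OF ts(1)]
    by (intro the_equality) (auto simp: nth_eq_iff_index_eq Suc_le_eq)
  then show ?thesis using ts by (simp add: local_swap_def)
qed

lemmas swap_prob_pmf =
  finite_atLeastAtMost[of 1 "fcard ts"]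
  swap_prob_nonneg[OF params fcard_ge_3 j(1,2)]
  swap_prob_eq_0[OF params fcard_ge_3 j(1,2)]
  sum_swap_prob[OF params fcard_ge_3 j(1,2)]

lemma expectation_local_swap:
  "measure_pmf.expectation (local_swap \<alpha> \<gamma> ts b i) F =
     (\<Sum>k=1..fcard ts. swap_prob \<alpha> \<gamma> (fcard ts) j k * F (least_labels ts ! (k - 1)))"
  unfolding local_swap_eq integral_map_pmf
  by (rule expectation_embed_pmf_finite[OF swap_prob_pmf])

lemma set_local_swap: "set_pmf (local_swap \<alpha> \<gamma> ts b i) \<subseteq> set (least_labels ts)"
  using set_embed_pmf_finite[OF swap_prob_pmf] length_least_labels[OF ts(1)]
  unfolding local_swap_eq by fastforce

end

lemma sorted_list_of_set_insert_greater:
  fixes A :: "'a::linorder set"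
  assumes "finite A" "\<And>x. x \<in> A \<Longrightarrow> x < y"
  shows "sorted_list_of_set (insert y A) = sorted_list_of_set A @ [y]"
proof (rule sorted_distinct_set_unique)
  show "distinct (sorted_list_of_set A @ [y])" using assms by auto
  show "sorted (sorted_list_of_set A @ [y])" using assms by (auto simp: sorted_append less_imp_le)
qed (use assms in \<open>simp_all del: sorted_list_of_set_insert_remove\<close>)

text \<open>The new label exceeds all others, so it is appended and the position of the selected
  leaf stays the same.\<close>

lemma least_labels_finsert:
  assumes "proper_tree (Node ts)" "\<And>l. l \<in> leaves (Node ts) \<Longrightarrow> l < n"
  shows "least_labels (finsert (Leaf n) ts) = least_labels ts @ [n]"
proof -
  have "least_label {u} < n" if "u \<in> fset ts" for u
    using least_label_in[OF proper_tree_child[OF assms(1) that]] assms(2) that by auto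
  then have "x < n" if "x \<in> (\<lambda>u. least_label {u}) ` fset ts" for x
    using that by (elim imageE) simp
  then have "sorted_list_of_set (insert n ((\<lambda>u. least_label {u}) ` fset ts)) =
      sorted_list_of_set ((\<lambda>u. least_label {u}) ` fset ts) @ [n]"
    by (intro sorted_list_of_set_insert_greater) simp_all
  then show ?thesis
    unfolding least_labels_def finsert.rep_eq image_insert least_label_singleton[of "Leaf n"]
    by simp
qed

context
  fixes \<alpha> \<gamma> :: real and ts :: "nat ltree fset" and n :: nat
  assumes params: "0 \<le> \<gamma>" "\<gamma> \<le> \<alpha>" and ts: "proper_tree (Node ts)"
    and n: "\<And>l. l \<in> leaves (Node ts) \<Longrightarrow> l < n"
begin

lemma fresh: "n \<notin> leaves (Node ts)"
  using n by blast

lemmas finsert_fresh = proper_tree_finsert_Leaf[OF ts fresh]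

lemma labels_finsert: "least_labels (finsert (Leaf n) ts) = least_labels ts @ [n]"
  using ts n by (rule least_labels_finsert)

lemma fcard_ge_2: "2 \<le> fcard ts"
  using ts by (simp add: proper_tree_Node_iff)

text \<open>The numerators of the old children are unchanged by the insertion, and the new child
  comes last with numerator \<alpha>. The factors are the weight of the branch point before the
  insertion and its weight once the selected leaf is removed.\<close>

lemma expectation_local_swap_finsert:
  assumes "Leaf i |\<in>| ts" "fcard ts \<noteq> 2"
  shows "((real (fcard ts) - 1) * \<alpha> - \<gamma>) *
      measure_pmf.expectation (local_swap \<alpha> \<gamma> (finsert (Leaf n) ts) b i) F =
    \<alpha> * F n + ((real (fcard ts) - 2) * \<alpha> - \<gamma>) *
      measure_pmf.expectation (local_swap \<alpha> \<gamma> ts b i) F"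
proof -
  define c where "c = fcard ts"
  have c: "3 \<le> c" using fcard_ge_2 assms(2) by (simp add: c_def)
  obtain j where j: "1 \<le> j" "j \<le> c" "least_labels ts ! (j - 1) = i"
    using least_labels_position[OF ts assms(1)] by (auto simp: c_def)
  have len: "length (least_labels ts) = c" using length_least_labels[OF ts] by (simp add: c_def)
  have j': "j \<le> fcard (finsert (Leaf n) ts)" "least_labels (finsert (Leaf n) ts) ! (j - 1) = i"
    using j len by (auto simp: finsert_fresh(2) c_def labels_finsert nth_append)
  have ne: "fcard (finsert (Leaf n) ts) \<noteq> 2" using c by (simp add: finsert_fresh(2) c_def)
  have "((real c - 1) * \<alpha> - \<gamma>) *
      measure_pmf.expectation (local_swap \<alpha> \<gamma> (finsert (Leaf n) ts) b i) F =
    (\<Sum>k=1..Suc c. ((real (Suc c) - 2) * \<alpha> - \<gamma>) * swap_prob \<alpha> \<gamma> (Suc c) j k *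
        F ((least_labels ts @ [n]) ! (k - 1)))"
    unfolding expectation_local_swap[OF params finsert_fresh(1) ne j(1) j'] sum_distrib_left
    by (intro sum.cong) (auto simp: finsert_fresh(2) c_def[symmetric] labels_finsert)
  also have "\<dots> = (\<Sum>k=1..Suc c. swap_num \<alpha> \<gamma> j k * F ((least_labels ts @ [n]) ! (k - 1)))"
    using j c by (intro sum.cong refl) (subst weight_mult_swap_prob[OF params]; auto)
  also have "\<dots> = (\<Sum>k=1..c. swap_num \<alpha> \<gamma> j k * F ((least_labels ts @ [n]) ! (k - 1))) + \<alpha> * F n"
    using j c by (simp add: len nth_append swap_num_def)
  also have "(\<Sum>k=1..c. swap_num \<alpha> \<gamma> j k * F ((least_labels ts @ [n]) ! (k - 1)))
      = (\<Sum>k=1..c. ((real c - 2) * \<alpha> - \<gamma>) * (swap_prob \<alpha> \<gamma> c j k * F (least_labels ts ! (k - 1))))"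
  proof (intro sum.cong refl)
    fix k assume k: "k \<in> {1..c}"
    then have "(least_labels ts @ [n]) ! (k - 1) = least_labels ts ! (k - 1)"
      using len by (auto simp: nth_append)
    then show "swap_num \<alpha> \<gamma> j k * F ((least_labels ts @ [n]) ! (k - 1)) =
        ((real c - 2) * \<alpha> - \<gamma>) * (swap_prob \<alpha> \<gamma> c j k * F (least_labels ts ! (k - 1)))"
      using weight_mult_swap_prob[OF params c j(1,2), of k] k by (simp flip: mult.assoc)
  qed
  also have "\<dots> = ((real c - 2) * \<alpha> - \<gamma>) * measure_pmf.expectation (local_swap \<alpha> \<gamma> ts b i) F"
    using expectation_local_swap[OF params ts assms(2), of j i] j
    by (simp add: sum_distrib_left c_def)
  finally show ?thesis by (simp add: c_def)
qed

text \<open>Two siblings become three, where the convention for \<open>c = 3\<close> always takes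
  the third least label, here that of the new leaf.\<close>

lemma expectation_local_swap_finsert_pair:
  fixes F :: "nat \<Rightarrow> real"
  assumes "Leaf i |\<in>| ts" "fcard ts = 2"
  shows "measure_pmf.expectation (local_swap \<alpha> \<gamma> (finsert (Leaf n) ts) b i) F = F n"
proof -
  obtain j where j: "1 \<le> j" "j \<le> 2" "least_labels ts ! (j - 1) = i"
    using least_labels_position[OF ts assms(1)] assms(2) by auto
  have len: "length (least_labels ts) = 2" using length_least_labels[OF ts] assms(2) by simp
  have j': "j \<le> fcard (finsert (Leaf n) ts)" "least_labels (finsert (Leaf n) ts) ! (j - 1) = i"
    using j len assms by (auto simp: finsert_fresh(2) labels_finsert nth_append)
  have ne: "fcard (finsert (Leaf n) ts) \<noteq> 2" using assms by (simp add: finsert_fresh(2))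
  have c: "fcard (finsert (Leaf n) ts) = 3" using assms by (simp add: finsert_fresh(2))
  have "measure_pmf.expectation (local_swap \<alpha> \<gamma> (finsert (Leaf n) ts) b i) F =
      (\<Sum>k=1..3. swap_prob \<alpha> \<gamma> 3 j k * F ((least_labels ts @ [n]) ! (k - 1)))"
    using expectation_local_swap[OF params finsert_fresh(1) ne j(1) j'] by (simp only: c labels_finsert)
  also have "{1..3} = {1, 2, 3::nat}" by auto
  finally show ?thesis using len by (simp add: swap_prob_def nth_append)
qed

lemma expectation_local_swap_finsert_self:
  "measure_pmf.expectation (local_swap \<alpha> \<gamma> (finsert (Leaf n) ts) b n) F = F n"
  for F :: "nat \<Rightarrow> real"
proof -
  define c where "c = fcard (finsert (Leaf n) ts)"
  have c: "c = Suc (fcard ts)" "3 \<le> c" using fcard_ge_2 by (auto simp: c_def finsert_fresh(2))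
  have lab: "least_labels (finsert (Leaf n) ts) ! (c - 1) = n"
    using length_least_labels[OF ts] by (simp add: c nth_append labels_finsert)
  have cc: "1 \<le> c" "c \<le> fcard (finsert (Leaf n) ts)" "fcard (finsert (Leaf n) ts) \<noteq> 2"
    using c(2) by (auto simp: c_def)
  have *: "swap_prob \<alpha> \<gamma> c c k = 0" if "k \<in> {1..c} - {c}" for k
    using swap_prob_last[OF params c(2), of k] that by auto
  have "(\<Sum>k=1..c. swap_prob \<alpha> \<gamma> c c k) = swap_prob \<alpha> \<gamma> c c c"
    using * cc(1) by (subst sum.remove[of _ c]) auto
  then have 1: "swap_prob \<alpha> \<gamma> c c c = 1" using sum_swap_prob[OF params c(2) cc(1)] by simp
  have "measure_pmf.expectation (local_swap \<alpha> \<gamma> (finsert (Leaf n) ts) b n) F =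
      (\<Sum>k=1..c. swap_prob \<alpha> \<gamma> c c k * F (least_labels (finsert (Leaf n) ts) ! (k - 1)))"
    using expectation_local_swap[OF params finsert_fresh(1) cc(3,1,2) lab] by (simp add: c_def)
  also have "\<dots> = F n"
    using * cc(1) lab 1 by (subst sum.remove[of _ c]) auto
  finally show ?thesis .
qed

end

section \<open>The swap law and its recursion over subtrees\<close>

text \<open>\<open>b\<close> stands for the least label of the second spinal bush in case that bush
  lies outside \<open>t\<close>. The value 0 gives the law in the chain; other values arise when
  \<open>t\<close> is a subtree of a larger tree.\<close>

definition swap_law :: "real \<Rightarrow> real \<Rightarrow> nat \<Rightarrow> nat ltree \<Rightarrow> nat \<Rightarrow> nat pmf" where
  "swap_law \<alpha> \<gamma> b t i =
     local_swap \<alpha> \<gamma> (children (the (parent t (Leaf i))))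
       (if ancestor t i 2 = None then b else least_label (spinal_bush t i 2)) i"

lemma ancestor_2: "ancestor t i 2 = Option.bind (parent t (Leaf i)) (parent t)"
  by (simp add: numeral_2_eq_2)

lemma bush_eq:
  assumes "proper_tree v" "u |\<in>| children v" "i \<in> leaves u"
  shows "{w \<in> fset (children v). i \<notin> leaves w} = fset (children v) - {u}"
proof (cases v)
  case (Node ts)
  have "i \<notin> leaves w \<longleftrightarrow> w \<noteq> u" if "w |\<in>| ts" for w
    using sibling_unique[of ts u w i] assms Node that by fastforce
  then show ?thesis by (auto simp: Node)
qed (use assms in auto)

lemma swap_label_eq:
  assumes "proper_tree t" "i \<in> leaves t" "t \<noteq> Leaf i"
  shows "swap_label \<alpha> \<gamma> t i = swap_law \<alpha> \<gamma> 0 t i"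
proof -
  obtain v where v: "parent t (Leaf i) = Some v" "v \<in> subtrees t" "Leaf i |\<in>| children v"
    using parent_SomeE[OF assms(1), of "Leaf i"] assms by auto
  have "spinal_bush t i 1 = fset (children v) - {Leaf i}"
    using bush_eq[OF proper_tree_subtrees[OF assms(1) v(2)] v(3)] v by (simp add: spinal_bush_def)
  moreover have "least_label (spinal_bush t i 2) = 0" if "ancestor t i 2 = None"
    using that by (simp add: spinal_bush_def least_label_def)
  ultimately show ?thesis
    unfolding swap_law_def swap_label_def local_swap_def least_labels_def Let_def
    by (simp add: v(1))
qed

lemma swap_law_child:
  assumes "proper_tree (Node ts)" "Leaf i |\<in>| ts"
  shows "swap_law \<alpha> \<gamma> b (Node ts) i = local_swap \<alpha> \<gamma> ts b i"
  unfolding swap_law_def ancestor_2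
  by (simp add: parent_Node_child[OF assms] parent_self[OF assms(1)])

text \<open>If \<open>i\<close> is a child of \<open>u\<close>, its second spinal bush consists of
  the siblings of \<open>u\<close>, which explains the new value of \<open>b\<close>; otherwise both
  bushes lie inside \<open>u\<close>.\<close>

lemma swap_law_deep:
  assumes "proper_tree (Node ts)" "u |\<in>| ts" "i \<in> leaves u" "u \<noteq> Leaf i"
  shows "swap_law \<alpha> \<gamma> b (Node ts) i = swap_law \<alpha> \<gamma> (least_label (fset ts - {u})) u i"
proof -
  note pu = proper_tree_child[OF assms(1,2)]
  obtain v where v: "parent u (Leaf i) = Some v" "v \<in> subtrees u" "Leaf i |\<in>| children v"
    using parent_SomeE[OF pu, of "Leaf i"] assms by auto
  have p: "parent (Node ts) (Leaf i) = Some v"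
    using parent_Node_deep[OF assms(1,2)] v assms by auto
  show ?thesis
  proof (cases "v = u")
    case True
    have "parent (Node ts) u = Some (Node ts)" by (rule parent_Node_child[OF assms(1,2)])
    moreover have "{w \<in> fset ts. i \<notin> leaves w} = fset ts - {u}"
      using bush_eq[OF assms(1), of u i] assms by simp
    ultimately show ?thesis
      unfolding swap_law_def spinal_bush_def ancestor_2
      using p v parent_self[OF pu] True by simp
  next
    case False
    then obtain w where "parent u v = Some w" using parent_SomeE[OF pu v(2)] by metis
    moreover have "parent (Node ts) v = parent u v"
      by (rule parent_Node_deep[OF assms(1,2) v(2) False])
    ultimately show ?thesis
      unfolding swap_law_def spinal_bush_def ancestor_2 using p v by simp
  qed
qed

lemma least_label_in_Union:
  assumes "finite S" "(\<Union>u\<in>S. leaves u) \<noteq> {}"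
  shows "least_label S \<in> (\<Union>u\<in>S. leaves u)"
proof -
  have "S \<noteq> {}" using assms(2) by auto
  then show ?thesis using Min_in[of "\<Union>u\<in>S. leaves u"] assms by (auto simp: least_label_def)
qed

lemma least_label_siblings_in:
  assumes "proper_tree (Node ts)" "u |\<in>| ts"
  shows "least_label (fset ts - {u}) \<in> leaves (Node ts) - leaves u"
  using least_label_in_Union[of "fset ts - {u}"] leaves_siblings[OF assms]
    leaves_child_psubset[OF assms] by auto

lemma least_label_insert_greater:
  assumes "finite S" "finite S'" "(\<Union>u\<in>S'. leaves u) = insert n (\<Union>u\<in>S. leaves u)"
    "(\<Union>u\<in>S. leaves u) \<noteq> {}" "\<And>l. l \<in> (\<Union>u\<in>S. leaves u) \<Longrightarrow> l < n"
  shows "least_label S' = least_label S"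
proof -
  have "S \<noteq> {}" "S' \<noteq> {}" using assms(3,4) by auto
  moreover have "Min (insert n (\<Union>u\<in>S. leaves u)) = Min (\<Union>u\<in>S. leaves u)"
  proof -
    have fin: "finite (\<Union>u\<in>S. leaves u)" using assms(1) by simp
    then have "Min (\<Union>u\<in>S. leaves u) < n" by (intro assms(5) Min_in assms(4))
    then show ?thesis by (simp only: Min_insert[OF fin assms(4)] min_def) simp
  qed
  ultimately show ?thesis using assms(3) by (simp add: least_label_def)
qed

text \<open>A label outside the tree can be chosen only as the maximum, hence as \<open>b\<close>
  with \<open>i \<le> b\<close>. This inequality later rules out the default value
  \<open>b = 0\<close>, as the labels are positive.\<close>

lemma set_local_swap_subset:
  assumes "0 \<le> \<gamma>" "\<gamma> \<le> \<alpha>" "proper_tree (Node ts)" "Leaf i |\<in>| ts"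
    "k \<in> set_pmf (local_swap \<alpha> \<gamma> ts b i)"
  shows "k \<in> leaves (Node ts) \<or> k = b \<and> i \<le> b"
proof (cases "fcard ts = 2")
  case True
  have "least_label (fset ts - {Leaf i}) \<in> leaves (Node ts)"
    using least_label_siblings_in[OF assms(3,4)] by blast
  moreover have "i \<in> leaves (Node ts)" using assms(4) by force
  ultimately show ?thesis
    using assms(5) True by (auto simp: local_swap_def max_def split: if_splits)
next
  case False
  obtain j where "1 \<le> j" "j \<le> fcard ts" "least_labels ts ! (j - 1) = i"
    by (rule least_labels_position[OF assms(3,4)])
  then show ?thesis
    using set_local_swap[OF assms(1-3) False] least_labels_subset[OF assms(3)] assms(5) by blast
qed

lemma set_swap_law_subset:
  assumes "proper_tree t" "i \<in> leaves t" "t \<noteq> Leaf i" "0 \<le> \<gamma>" "\<gamma> \<le> \<alpha>"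
    "k \<in> set_pmf (swap_law \<alpha> \<gamma> b t i)"
  shows "k \<in> leaves t \<or> k = b \<and> i \<le> b"
  using assms(1-3,6)
proof (induction t arbitrary: b rule: proper_tree_induct)
  case (Node ts)
  from Node.prems(1) show ?case
  proof (cases rule: leaf_location_cases)
    case child
    then show ?thesis
      using set_local_swap_subset[OF assms(4,5) Node.hyps child] Node.prems
        swap_law_child[OF Node.hyps child] by simp
  next
    case (deep u)
    have "k \<in> leaves u \<or> k = least_label (fset ts - {u})"
      using Node.IH[OF deep] Node.prems(3) swap_law_deep[OF Node.hyps deep] by auto
    then show ?thesis
      using least_label_siblings_in[OF Node.hyps deep(1)] deep(1) by auto
  qed
qed auto

lemma finite_swap_law:
  assumes "proper_tree t" "i \<in> leaves t" "t \<noteq> Leaf i" "0 \<le> \<gamma>" "\<gamma> \<le> \<alpha>"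
  shows "finite (set_pmf (swap_law \<alpha> \<gamma> b t i))"
  by (rule finite_subset[of _ "insert b (leaves t)"]) (use set_swap_law_subset[OF assms] in auto)

lemma least_label_repl:
  assumes ts: "proper_tree (Node ts)" "\<And>l. l \<in> leaves (Node ts) \<Longrightarrow> l < n"
    and w: "w |\<in>| ts" "u |\<in>| ts" "w \<noteq> u"
    and w': "leaves w' = insert n (leaves w)"
  shows "least_label (fset (repl w w' ts) - {u}) = least_label (fset ts - {u})"
proof -
  have nonempty: "leaves w \<noteq> {}" using leaves_nonempty proper_tree_child[OF ts(1) w(1)] by blast
  have n: "n \<notin> leaves (Node ts)" using ts(2) by blast
  then have ne: "w' \<noteq> u" using w w' by auto
  have eq: "fset (repl w w' ts) - {u} = insert w' (fset ts - {u} - {w})" using ne by auto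
  have eq': "fset ts - {u} = insert w (fset ts - {u} - {w})" using w by auto
  have "(\<Union>v\<in>insert w' (fset ts - {u} - {w}). leaves v)
      = insert n (\<Union>v\<in>insert w (fset ts - {u} - {w}). leaves v)"
    unfolding UN_insert w' by auto
  then have "least_label (insert w' (fset ts - {u} - {w})) = least_label (insert w (fset ts - {u} - {w}))"
    using nonempty ts(2) w(1) by (intro least_label_insert_greater[of _ _ n]) auto
  then show ?thesis unfolding eq using eq' by simp
qed

text \<open>An insertion into a sibling adds only a label larger than all others, so neither the
  number of children nor any least label changes.\<close>

lemma local_swap_repl:
  assumes ts: "proper_tree (Node ts)" "\<And>l. l \<in> leaves (Node ts) \<Longrightarrow> l < n"
    and w: "w |\<in>| ts" "w \<noteq> Leaf i" "Leaf i |\<in>| ts"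
    and w': "proper_tree w'" "leaves w' = insert n (leaves w)"
  shows "local_swap \<alpha> \<gamma> (repl w w' ts) b i = local_swap \<alpha> \<gamma> ts b i"
proof -
  have n: "n \<notin> leaves (Node ts)" using ts(2) by blast
  have disj: "leaves w' \<inter> (\<Union>v\<in>fset ts - {w}. leaves v) = {}"
    using n unfolding leaves_siblings[OF ts(1) w(1)] w' by auto
  have notin: "w' |\<notin>| ts |-| {|w|}"
    by (rule notin_siblings[OF ts(1) w(1) leaves_nonempty[OF w'(1)] disj])
  have c: "fcard (repl w w' ts) = fcard ts" by (rule fcard_repl[OF w(1) notin])
  have nonempty: "leaves w \<noteq> {}" using leaves_nonempty proper_tree_child[OF ts(1) w(1)] by blast
  have lt: "l < n" if "l \<in> leaves w" for l using ts(2)[of l] that w(1) by auto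
  have "least_label {w'} = least_label {w}"
    by (rule least_label_insert_greater[of _ _ n]) (use nonempty lt w' in auto)
  then have "(\<lambda>u. least_label {u}) ` fset (repl w w' ts) = (\<lambda>u. least_label {u}) ` fset ts"
    using w(1) by force
  then have labs: "least_labels (repl w w' ts) = least_labels ts" by (simp add: least_labels_def)
  have "least_label (fset (repl w w' ts) - {Leaf i}) = least_label (fset ts - {Leaf i})"
    by (rule least_label_repl[OF ts w(1,3,2) w'(2)])
  then show ?thesis unfolding local_swap_def c labs by simp
qed

lemma local_swap_cong_b: "fcard ts \<noteq> 2 \<Longrightarrow> local_swap \<alpha> \<gamma> ts b i = local_swap \<alpha> \<gamma> ts b' i"
  by (simp add: local_swap_def)

lemma local_swap_pair_max:
  assumes "proper_tree (Node ts)" "\<And>l. l \<in> leaves (Node ts) \<Longrightarrow> l < n" "Leaf i |\<in>| ts" "fcard ts = 2"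
  shows "local_swap \<alpha> \<gamma> ts n i = return_pmf n"
proof -
  have "least_label (fset ts - {Leaf i}) < n"
    using least_label_siblings_in[OF assms(1,3)] assms(2) by blast
  moreover have "i < n" using assms(2,3) by force
  ultimately show ?thesis using assms(4) by (simp add: local_swap_def max_def)
qed

lemma local_swap_cherry:
  assumes "i < n" "b \<le> n"
  shows "local_swap \<alpha> \<gamma> {|Leaf n, Leaf i|} b i = return_pmf n"
    and "local_swap \<alpha> \<gamma> {|Leaf n, Leaf i|} b n = return_pmf n"
proof -
  have c: "fcard {|Leaf n, Leaf i|} = 2" using assms by (simp add: fcard.rep_eq)
  have "{Leaf n, Leaf i} - {Leaf i} = {Leaf n}" "{Leaf n, Leaf i} - {Leaf n} = {Leaf i}"
    using assms by auto
  then show "local_swap \<alpha> \<gamma> {|Leaf n, Leaf i|} b i = return_pmf n"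
    "local_swap \<alpha> \<gamma> {|Leaf n, Leaf i|} b n = return_pmf n"
    using assms c by (simp_all add: local_swap_def least_label_singleton max_def)
qed

section \<open>Insertion followed by the removal of an older leaf\<close>

lemma expectation_ins_sum:
  assumes "finite (set_pmf p)"
  shows "measure_pmf.expectation p (\<lambda>k. ins_sum \<alpha> \<gamma> j t (\<lambda>t'. G t' k)) =
    ins_sum \<alpha> \<gamma> j t (\<lambda>t'. measure_pmf.expectation p (G t'))"
  unfolding ins_sum_def using integrable_measure_pmf_finite[OF assms]
  by (subst Bochner_Integration.integral_sum) auto

lemma map_transpose_fresh: "i \<notin> leaves t \<Longrightarrow> n \<notin> leaves t \<Longrightarrow> map_ltree (Transposition.transpose i n) t = t"
  by (rule ltree.map_ident_strong) (auto simp: Transposition.transpose_def)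

lemma map_transpose_Node:
  assumes "proper_tree (Node ts)" "u |\<in>| ts" "i \<in> leaves u" "n \<notin> leaves (Node ts)"
  shows "map_ltree (Transposition.transpose i n) (Node ts) = Node (repl u (map_ltree (Transposition.transpose i n) u) ts)"
proof -
  have "map_ltree (Transposition.transpose i n) w = w" if "w |\<in>| ts" "w \<noteq> u" for w
    using that assms sibling_unique[OF assms(1,2) that(1)]
    by (intro map_transpose_fresh) auto
  then show ?thesis using fimage_eq_repl[OF assms(2)] by simp
qed

lemma repl_repl:
  assumes "u' |\<notin>| ts |-| {|u|}"
  shows "repl u' u'' (repl u u' ts) = repl u u'' ts" "fset (repl u u' ts) - {u'} = fset ts - {u}"
  using assms by auto

context
  fixes \<alpha> \<gamma> :: real and s :: "nat ltree" and n i :: nat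
  assumes s: "proper_tree s" "i \<in> leaves s" "s \<noteq> Leaf i" and n: "n \<notin> leaves s"
begin

text \<open>For a leaf attached to the root branch point of \<open>s\<close>, the new leaf above
  \<open>s\<close> is now the whole second spinal bush, so the outside label becomes
  \<open>n\<close>. This is why \<open>b\<close> cannot stay fixed.\<close>

lemma swap_law_edge: "swap_law \<alpha> \<gamma> b (Node {|Leaf n, s|}) i = swap_law \<alpha> \<gamma> n s i"
proof -
  have "{Leaf n, s} - {s} = {Leaf n}" using n by auto
  then show ?thesis
    using swap_law_deep[OF proper_tree_Node_insert[OF s(1) n], of s i] s
    by (simp add: least_label_singleton)
qed

lemma delete_leaf_edge: "delete_leaf i (Node {|Leaf n, s|}) = Node {|Leaf n, delete_leaf i s|}"
proof -
  have "repl s (delete_leaf i s) {|Leaf n, s|} = {|Leaf n, delete_leaf i s|}" using n by auto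
  then show ?thesis
    using delete_leaf_deep[OF proper_tree_Node_insert[OF s(1) n], of s i] s by simp
qed

end

lemma delete_leaf_fresh_cherry: "i \<noteq> n \<Longrightarrow> delete_leaf i (Node {|Leaf n, Leaf i|}) = Leaf n"
  using delete_leaf_pair[of i "Leaf n"] proper_tree_Node_insert[of "Leaf n" i]
  by (simp add: proper_tree.intros finsert_commute)

context
  fixes ts :: "nat ltree fset" and n :: nat
  assumes ts: "proper_tree (Node ts)" and n_fresh: "n \<notin> leaves (Node ts)"
begin

lemma fresh_repl:
  assumes u: "u |\<in>| ts" and t: "proper_tree t" "leaves t = insert n (leaves u)"
  shows "proper_tree (Node (repl u t ts))" "t |\<notin>| ts |-| {|u|}" "w |\<in>| ts \<Longrightarrow> t \<noteq> w"
proof -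
  have disj: "leaves t \<inter> (\<Union>w\<in>fset ts - {u}. leaves w) = {}"
    using n_fresh unfolding leaves_siblings[OF ts u] t(2) by auto
  show "proper_tree (Node (repl u t ts))" by (rule proper_tree_repl[OF ts u t(1) disj])
  show "t |\<notin>| ts |-| {|u|}" by (rule notin_siblings[OF ts u leaves_nonempty[OF t(1)] disj])
  show "w |\<in>| ts \<Longrightarrow> t \<noteq> w" using n_fresh t(2) by auto
qed

end

context
  fixes \<alpha> \<gamma> :: real and ts :: "nat ltree fset" and n i :: nat and F :: "nat ltree \<Rightarrow> nat \<Rightarrow> real"
  assumes params: "0 \<le> \<gamma>" "\<gamma> \<le> \<alpha>" and ts: "proper_tree (Node ts)"
    and lt_n: "\<And>l. l \<in> leaves (Node ts) \<Longrightarrow> l < n" and child: "Leaf i |\<in>| ts"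
begin

lemma n_fresh: "n \<notin> leaves (Node ts)"
  using lt_n by blast

lemma i_neq_n: "i \<noteq> n" "i < n"
  using child lt_n[of i] by force+

lemma expectation_branch_child:
  "measure_pmf.expectation (swap_law \<alpha> \<gamma> b (Node (finsert (Leaf n) ts)) i)
     (F (delete_leaf i (Node (finsert (Leaf n) ts)))) =
   measure_pmf.expectation (local_swap \<alpha> \<gamma> (finsert (Leaf n) ts) b i)
     (F (Node (finsert (Leaf n) (ts |-| {|Leaf i|}))))"
proof -
  note p = proper_tree_finsert_Leaf[OF ts n_fresh]
  have c: "Leaf i |\<in>| finsert (Leaf n) ts" using child by simp
  have "fcard (finsert (Leaf n) ts) \<noteq> 2" using p ts by (simp add: proper_tree_Node_iff)
  moreover have "finsert (Leaf n) ts |-| {|Leaf i|} = finsert (Leaf n) (ts |-| {|Leaf i|})"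
    using i_neq_n by auto
  ultimately show ?thesis using delete_leaf_child[OF p(1) c] swap_law_child[OF p(1) c] by simp
qed

text \<open>In the cherry of \<open>i\<close> and the new leaf, \<open>n\<close> exceeds both
  \<open>i\<close> and the second spinal bush and is therefore picked; removing \<open>i\<close>
  suppresses their parent and leaves \<open>n\<close> in the place of \<open>i\<close>.\<close>

lemma expectation_leaf_edge:
  "measure_pmf.expectation (swap_law \<alpha> \<gamma> b (Node (repl (Leaf i) (Node {|Leaf n, Leaf i|}) ts)) i)
     (F (delete_leaf i (Node (repl (Leaf i) (Node {|Leaf n, Leaf i|}) ts)))) =
   F (Node (finsert (Leaf n) (ts |-| {|Leaf i|}))) n"
proof -
  let ?t = "Node {|Leaf n, Leaf i|}"
  have t: "proper_tree ?t" "leaves ?t = insert n (leaves (Leaf i))"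
    using proper_tree_Node_insert[of "Leaf i" n] i_neq_n by (auto intro: proper_tree.intros)
  note r = fresh_repl[OF ts n_fresh child t]
  have in_t: "?t |\<in>| repl (Leaf i) ?t ts" "i \<in> leaves ?t" "?t \<noteq> Leaf i" by auto
  define b' where "b' = least_label (fset ts - {Leaf i})"
  have "b' \<in> leaves (Node ts)" using least_label_siblings_in[OF ts child] by (auto simp: b'_def)
  then have b': "b' \<le> n" using lt_n by (simp add: less_imp_le)
  have "swap_law \<alpha> \<gamma> b (Node (repl (Leaf i) ?t ts)) i = swap_law \<alpha> \<gamma> b' ?t i"
    using swap_law_deep[OF r(1) in_t] unfolding repl_repl(2)[OF r(2)] b'_def .
  also have "\<dots> = return_pmf n"
    using swap_law_child[OF t(1), of i] local_swap_cherry(1)[OF i_neq_n(2) b'] by simp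
  finally have "swap_law \<alpha> \<gamma> b (Node (repl (Leaf i) ?t ts)) i = return_pmf n" .
  moreover have "delete_leaf i (Node (repl (Leaf i) ?t ts)) = Node (finsert (Leaf n) (ts |-| {|Leaf i|}))"
    using delete_leaf_deep[OF r(1) in_t]
    unfolding repl_repl(1)[OF r(2)] delete_leaf_fresh_cherry[OF i_neq_n(1)] .
  ultimately show ?thesis by simp
qed

text \<open>An insertion inside a sibling does not affect the swap law and commutes with the removal
  of \<open>i\<close>. If there are only two children, the parent is suppressed and the sibling
  takes its place.\<close>

lemma ins_sum_sibling:
  assumes w: "w |\<in>| ts" "w \<noteq> Leaf i"
  shows "ins_sum \<alpha> \<gamma> n w (\<lambda>t. measure_pmf.expectation (swap_law \<alpha> \<gamma> b (Node (repl w t ts)) i)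
      (F (delete_leaf i (Node (repl w t ts))))) =
    measure_pmf.expectation (local_swap \<alpha> \<gamma> ts b i) (\<lambda>k. ins_sum \<alpha> \<gamma> n w (\<lambda>t.
      F (if fcard ts = 2 then t else Node (repl w t (ts |-| {|Leaf i|}))) k))"
proof -
  have "n \<notin> leaves w" using n_fresh w by auto
  have eq: "measure_pmf.expectation (swap_law \<alpha> \<gamma> b (Node (repl w t ts)) i)
      (F (delete_leaf i (Node (repl w t ts)))) = measure_pmf.expectation (local_swap \<alpha> \<gamma> ts b i)
      (F (if fcard ts = 2 then t else Node (repl w t (ts |-| {|Leaf i|}))))"
    if t: "proper_tree t" "leaves t = insert n (leaves w)" for t
  proof -
    note r = fresh_repl[OF ts n_fresh w(1) t]
    have c: "Leaf i |\<in>| repl w t ts" using child w by auto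
    have ti: "t \<noteq> Leaf i" using r(3)[OF child] .
    have "swap_law \<alpha> \<gamma> b (Node (repl w t ts)) i = local_swap \<alpha> \<gamma> ts b i"
      using swap_law_child[OF r(1) c] local_swap_repl[OF ts lt_n w child t] by simp
    moreover have "delete_leaf i (Node (repl w t ts)) =
        (if fcard ts = 2 then t else Node (repl w t (ts |-| {|Leaf i|})))"
    proof (cases "fcard ts = 2")
      case True
      then obtain v where "ts = {|Leaf i, v|}" "v \<noteq> Leaf i" by (rule fcard_2_obtain[OF _ child])
      then have "repl w t ts = {|Leaf i, t|}" using w by auto
      then show ?thesis using delete_leaf_pair[of i t] r(1) ti True by simp
    next
      case False
      have "repl w t ts |-| {|Leaf i|} = repl w t (ts |-| {|Leaf i|})" using ti by auto
      then show ?thesis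
        using delete_leaf_child[OF r(1) c] fcard_repl[OF w(1) r(2)] False by simp
    qed
    ultimately show ?thesis by simp
  qed
  have p: "proper_tree (Node ts)" "i \<in> leaves (Node ts)" "Node ts \<noteq> Leaf i"
    using ts child by force+
  have "finite (set_pmf (local_swap \<alpha> \<gamma> ts b i))"
    using finite_swap_law[OF p params] swap_law_child[OF ts child] by simp
  note fin = this
  show ?thesis
    by (subst expectation_ins_sum[OF fin],
        intro ins_sum_cong[OF proper_tree_child[OF ts w(1)] \<open>n \<notin> leaves w\<close>], rule eq)
qed

text \<open>The total mass 1 of the first term is produced here and only passed on elsewhere. The
  cases differ because a parent with two children disappears together with \<open>i\<close>, and its
  edge and its own weight disappear with it.\<close>

lemma ins_sum_swap_child:
  "ins_sum \<alpha> \<gamma> n (Node ts)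
     (\<lambda>t. measure_pmf.expectation (swap_law \<alpha> \<gamma> b t i) (F (delete_leaf i t))) =
   F (map_ltree (Transposition.transpose i n) (Node ts)) n +
   measure_pmf.expectation (swap_law \<alpha> \<gamma> b (Node ts) i)
     (\<lambda>k. ins_sum \<alpha> \<gamma> n (delete_leaf i (Node ts)) (\<lambda>t. F t k))"
proof -
  define us where "us = ts |-| {|Leaf i|}"
  define P where "P = local_swap \<alpha> \<gamma> ts b i"
  define X where "X = F (Node (finsert (Leaf n) us)) n"
  have p: "proper_tree (Node ts)" "i \<in> leaves (Node ts)" "Node ts \<noteq> Leaf i"
    using ts child by force+
  have P: "swap_law \<alpha> \<gamma> b (Node ts) i = P" using swap_law_child[OF ts child] by (simp add: P_def)
  have "finite (set_pmf P)" using finite_swap_law[OF p params] P by metis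
  then have int: "integrable (measure_pmf P) f" for f :: "nat \<Rightarrow> real"
    by (rule integrable_measure_pmf_finite)
  have map: "map_ltree (Transposition.transpose i n) (Node ts) = Node (finsert (Leaf n) us)"
    using map_transpose_Node[OF ts child _ n_fresh] by (simp add: us_def)
  have us: "fset us = fset ts - {Leaf i}" by (simp add: us_def)
  have "(\<Sum>w\<in>fset ts. ins_sum \<alpha> \<gamma> n w (\<lambda>t. measure_pmf.expectation
        (swap_law \<alpha> \<gamma> b (Node (repl w t ts)) i) (F (delete_leaf i (Node (repl w t ts)))))) =
      (1 - \<alpha>) * X + (\<Sum>w\<in>fset us. measure_pmf.expectation P (\<lambda>k. ins_sum \<alpha> \<gamma> n w (\<lambda>t.
        F (if fcard ts = 2 then t else Node (repl w t us)) k)))"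
    unfolding sum.remove[OF finite_fset child] ins_sum_Leaf expectation_leaf_edge
    unfolding us_def[symmetric] X_def[symmetric] us
    using ins_sum_sibling[where b = b, folded us_def P_def]
    by (intro arg_cong2[of _ _ _ _ "(+)"] refl sum.cong) auto
  then have lhs: "ins_sum \<alpha> \<gamma> n (Node ts)
     (\<lambda>t. measure_pmf.expectation (swap_law \<alpha> \<gamma> b t i) (F (delete_leaf i t))) =
    \<gamma> * measure_pmf.expectation (local_swap \<alpha> \<gamma> ts n i) (F (Node {|Leaf n, delete_leaf i (Node ts)|})) +
    ((real (fcard ts) - 1) * \<alpha> - \<gamma>) *
      measure_pmf.expectation (local_swap \<alpha> \<gamma> (finsert (Leaf n) ts) b i) (F (Node (finsert (Leaf n) us))) +
    ((1 - \<alpha>) * X + (\<Sum>w\<in>fset us. measure_pmf.expectation P (\<lambda>k. ins_sum \<alpha> \<gamma> n w (\<lambda>t.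
        F (if fcard ts = 2 then t else Node (repl w t us)) k))))"
    unfolding ins_sum_Node[OF ts] expectation_branch_child us_def[symmetric]
      swap_law_edge[OF p n_fresh] delete_leaf_edge[OF p n_fresh] swap_law_child[OF ts child]
    by simp
  show ?thesis
  proof (cases "fcard ts = 2")
    case True
    then obtain w where w: "ts = {|Leaf i, w|}" "w \<noteq> Leaf i" by (rule fcard_2_obtain[OF _ child])
    have us_w: "us = {|w|}" using w by (auto simp: us_def)
    have del: "delete_leaf i (Node ts) = w" using delete_leaf_pair[of i w] ts w by simp
    show ?thesis
      unfolding lhs map P del
      using True local_swap_pair_max[OF ts lt_n child True]
        expectation_local_swap_finsert_pair[OF params ts lt_n child True]
      by (simp add: X_def us_w algebra_simps)
  next
    case False
    have del: "delete_leaf i (Node ts) = Node us"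
      using delete_leaf_child[OF ts child] False by (simp add: us_def)
    have pus: "proper_tree (Node us)" using proper_tree_delete_leaf[OF p] del by simp
    have c: "real (fcard us) = real (fcard ts) - 1"
      using child False ts by (simp add: us_def fcard.rep_eq proper_tree_Node_iff of_nat_diff)
    have "measure_pmf.expectation P (\<lambda>k. ins_sum \<alpha> \<gamma> n (Node us) (\<lambda>t. F t k)) =
      \<gamma> * measure_pmf.expectation P (F (Node {|Leaf n, Node us|})) +
      ((real (fcard ts) - 2) * \<alpha> - \<gamma>) * measure_pmf.expectation P (F (Node (finsert (Leaf n) us))) +
      (\<Sum>w\<in>fset us. measure_pmf.expectation P
         (\<lambda>k. ins_sum \<alpha> \<gamma> n w (\<lambda>t. F (Node (repl w t us)) k)))"
      unfolding ins_sum_Node[OF pus] c by (simp add: int algebra_simps)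
    then show ?thesis
      unfolding lhs map P del X_def
      using expectation_local_swap_finsert[OF params ts lt_n child False,
          where b = b and F = "F (Node (finsert (Leaf n) us))"]
        local_swap_cong_b[OF False, of \<alpha> \<gamma> n i b] False
      by (simp add: P_def algebra_simps)
  qed
qed

end

text \<open>The commutation for one selected leaf. \<open>F\<close> takes the tree without
  \<open>i\<close> and the chosen label \<open>k\<close>, since the final relabelling depends on
  both; if \<open>n\<close> is chosen, it has taken the place of \<open>i\<close>, whence the
  transposition. In total weights this reads \<open>m - \<alpha> = 1 + (m - 1 - \<alpha>)\<close>
  for \<open>m\<close> leaves.\<close>

lemma ins_sum_swap:
  fixes F :: "nat ltree \<Rightarrow> nat \<Rightarrow> real"
  assumes params: "0 \<le> \<gamma>" "\<gamma> \<le> \<alpha>"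
    and "proper_tree s" "i \<in> leaves s" "s \<noteq> Leaf i" "\<And>l. l \<in> leaves s \<Longrightarrow> l < n"
  shows "ins_sum \<alpha> \<gamma> n s
     (\<lambda>t. measure_pmf.expectation (swap_law \<alpha> \<gamma> b t i) (F (delete_leaf i t))) =
   F (map_ltree (Transposition.transpose i n) s) n +
   measure_pmf.expectation (swap_law \<alpha> \<gamma> b s i)
     (\<lambda>k. ins_sum \<alpha> \<gamma> n (delete_leaf i s) (\<lambda>t. F t k))"
  using assms(3-)
proof (induction s arbitrary: b F rule: proper_tree_induct)
  case (Node ts)
  note ts = Node.hyps and lt_n = Node.prems(3)
  from Node.prems(1) show ?case
  proof (cases rule: leaf_location_cases)
    case child
    show ?thesis by (rule ins_sum_swap_child[OF params ts lt_n child])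
  next
    case (deep u)
    have fr: "n \<notin> leaves (Node ts)" using lt_n by blast
    define d where "d = delete_leaf i u"
    define ts2 where "ts2 = repl u d ts"
    define b' where "b' = least_label (fset ts - {u})"
    define P where "P = swap_law \<alpha> \<gamma> b' u i"
    have pu: "proper_tree u" by (rule proper_tree_child[OF ts deep(1)])
    have fr_u: "n \<notin> leaves u" "\<And>l. l \<in> leaves u \<Longrightarrow> l < n" using fr lt_n deep(1) by auto
    have "finite (set_pmf P)" using finite_swap_law[OF pu deep(2,3) params] by (simp add: P_def)
    note fin = this
    then have int: "integrable (measure_pmf P) f" for f :: "nat \<Rightarrow> real"
      by (rule integrable_measure_pmf_finite)
    have P: "swap_law \<alpha> \<gamma> b'' (Node ts) i = P" for b''
      using swap_law_deep[OF ts deep] by (simp add: P_def b'_def)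
    have del: "delete_leaf i (Node ts) = Node ts2"
      using delete_leaf_deep[OF ts deep] by (simp add: ts2_def d_def)
    have p2: "proper_tree (Node ts2)"
      using proper_tree_delete_leaf[OF ts Node.prems(1,2)] del by simp
    have d: "proper_tree d" "leaves d = leaves u - {i}"
      using proper_tree_delete_leaf[OF pu deep(2,3)] by (auto simp: d_def)
    have d_disj: "leaves d \<inter> (\<Union>w\<in>fset ts - {u}. leaves w) = {}"
      unfolding leaves_siblings[OF ts deep(1)] d by auto
    have d_notin: "d |\<notin>| ts |-| {|u|}"
      by (rule notin_siblings[OF ts deep(1) leaves_nonempty[OF d(1)] d_disj])
    \<comment> \<open>Removing a leaf deeper down keeps the number of children at the root branch
      point, so the weights of the top edge and of this branch point agree on both sides.\<close>
    have c2: "fcard ts2 = fcard ts" unfolding ts2_def by (rule fcard_repl[OF deep(1) d_notin])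
    have fset2: "fset ts2 - {d} = fset ts - {u}" "d |\<in>| ts2"
      using repl_repl(2)[OF d_notin] by (auto simp: ts2_def)
    have branch: "measure_pmf.expectation (swap_law \<alpha> \<gamma> b (Node (finsert (Leaf n) ts)) i)
        (F (delete_leaf i (Node (finsert (Leaf n) ts)))) =
      measure_pmf.expectation P (F (Node (finsert (Leaf n) ts2)))"
    proof -
      note p = proper_tree_finsert_Leaf(1)[OF ts fr]
      have u: "u |\<in>| finsert (Leaf n) ts" using deep(1) by simp
      have un: "u \<noteq> Leaf n" using fr_u by auto
      have "least_label (fset (finsert (Leaf n) ts) - {u}) = b'"
        unfolding b'_def
      proof (rule least_label_insert_greater[of _ _ n])
        show "(\<Union>w\<in>fset (finsert (Leaf n) ts) - {u}. leaves w) =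
            insert n (\<Union>w\<in>fset ts - {u}. leaves w)"
          using un by auto
        show "(\<Union>w\<in>fset ts - {u}. leaves w) \<noteq> {}"
          using leaves_siblings[OF ts deep(1)] leaves_child_psubset[OF ts deep(1)] by auto
        show "l < n" if "l \<in> (\<Union>w\<in>fset ts - {u}. leaves w)" for l
          using that unfolding leaves_siblings[OF ts deep(1)] using lt_n by blast
      qed auto
      then have "swap_law \<alpha> \<gamma> b (Node (finsert (Leaf n) ts)) i = P"
        using swap_law_deep[OF p u deep(2,3)] by (simp add: P_def)
      moreover have "repl u d (finsert (Leaf n) ts) = finsert (Leaf n) ts2"
        using un by (auto simp: ts2_def)
      then have "delete_leaf i (Node (finsert (Leaf n) ts)) = Node (finsert (Leaf n) ts2)"
        using delete_leaf_deep[OF p u deep(2,3)] by (simp add: d_def)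
      ultimately show ?thesis by simp
    qed
    have sibling: "ins_sum \<alpha> \<gamma> n w (\<lambda>t. measure_pmf.expectation
          (swap_law \<alpha> \<gamma> b (Node (repl w t ts)) i) (F (delete_leaf i (Node (repl w t ts))))) =
        measure_pmf.expectation P (\<lambda>k. ins_sum \<alpha> \<gamma> n w (\<lambda>t. F (Node (repl w t ts2)) k))"
      if w: "w |\<in>| ts" "w \<noteq> u" for w
    proof -
      have fr_w: "n \<notin> leaves w" using fr w by auto
      have "measure_pmf.expectation
          (swap_law \<alpha> \<gamma> b (Node (repl w t ts)) i) (F (delete_leaf i (Node (repl w t ts)))) =
          measure_pmf.expectation P (F (Node (repl w t ts2)))"
        if t: "proper_tree t" "leaves t = insert n (leaves w)" for t
      proof -
        note r = fresh_repl[OF ts fr w(1) t]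
        have u: "u |\<in>| repl w t ts" using deep(1) w by auto
        have tu: "t \<noteq> u" using r(3)[OF deep(1)] .
        have "swap_law \<alpha> \<gamma> b (Node (repl w t ts)) i = P"
          using swap_law_deep[OF r(1) u deep(2,3)]
            least_label_repl[OF ts _ w(1) deep(1) w(2) t(2)] lt_n
          unfolding P_def b'_def by simp
        moreover have "d \<noteq> w" using d_notin w by auto
        then have "repl u d (repl w t ts) = repl w t ts2"
          using tu w(2) by (auto simp: ts2_def)
        then have "delete_leaf i (Node (repl w t ts)) = Node (repl w t ts2)"
          using delete_leaf_deep[OF r(1) u deep(2,3)] by (simp add: d_def)
        ultimately show ?thesis by simp
      qed
      then show ?thesis
        unfolding expectation_ins_sum[OF fin]
        by (intro ins_sum_cong[OF proper_tree_child[OF ts w(1)] fr_w])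
    qed
    have "ins_sum \<alpha> \<gamma> n u (\<lambda>t. measure_pmf.expectation
          (swap_law \<alpha> \<gamma> b (Node (repl u t ts)) i) (F (delete_leaf i (Node (repl u t ts))))) =
        ins_sum \<alpha> \<gamma> n u (\<lambda>t. measure_pmf.expectation (swap_law \<alpha> \<gamma> b' t i)
          (F (Node (repl u (delete_leaf i t) ts))))"
    proof (rule ins_sum_cong[OF pu fr_u(1)])
      fix t assume t: "proper_tree t" "leaves t = insert n (leaves u)"
      note r = fresh_repl[OF ts fr deep(1) t]
      have t_in: "t |\<in>| repl u t ts" "i \<in> leaves t" "t \<noteq> Leaf i"
        using deep(2) t fr_u by auto
      have "swap_law \<alpha> \<gamma> b (Node (repl u t ts)) i = swap_law \<alpha> \<gamma> b' t i"
        using swap_law_deep[OF r(1) t_in] unfolding repl_repl(2)[OF r(2)] b'_def .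
      moreover have "delete_leaf i (Node (repl u t ts)) = Node (repl u (delete_leaf i t) ts)"
        using delete_leaf_deep[OF r(1) t_in] unfolding repl_repl(1)[OF r(2)] .
      ultimately show "measure_pmf.expectation (swap_law \<alpha> \<gamma> b (Node (repl u t ts)) i)
          (F (delete_leaf i (Node (repl u t ts)))) = measure_pmf.expectation (swap_law \<alpha> \<gamma> b' t i)
          (F (Node (repl u (delete_leaf i t) ts)))" by simp
    qed
    also have "\<dots> = F (Node (repl u (map_ltree (Transposition.transpose i n) u) ts)) n +
        measure_pmf.expectation P (\<lambda>k. ins_sum \<alpha> \<gamma> n d (\<lambda>t. F (Node (repl u t ts)) k))"
      using Node.IH[OF deep fr_u(2), where F = "\<lambda>t. F (Node (repl u t ts))" and b = b']
      by (simp add: P_def d_def)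
    also have "Node (repl u (map_ltree (Transposition.transpose i n) u) ts) = map_ltree (Transposition.transpose i n) (Node ts)"
      using map_transpose_Node[OF ts deep(1,2) fr] ..
    finally have own: "ins_sum \<alpha> \<gamma> n u (\<lambda>t. measure_pmf.expectation
          (swap_law \<alpha> \<gamma> b (Node (repl u t ts)) i) (F (delete_leaf i (Node (repl u t ts))))) =
        F (map_ltree (Transposition.transpose i n) (Node ts)) n +
        measure_pmf.expectation P (\<lambda>k. ins_sum \<alpha> \<gamma> n d (\<lambda>t. F (Node (repl d t ts2)) k))"
      using repl_repl(1)[OF d_notin] by (simp only: ts2_def)
    have "measure_pmf.expectation P (\<lambda>k. ins_sum \<alpha> \<gamma> n (Node ts2) (\<lambda>t. F t k)) =
      \<gamma> * measure_pmf.expectation P (F (Node {|Leaf n, Node ts2|})) +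
      ((real (fcard ts) - 1) * \<alpha> - \<gamma>) * measure_pmf.expectation P (F (Node (finsert (Leaf n) ts2))) +
      (measure_pmf.expectation P (\<lambda>k. ins_sum \<alpha> \<gamma> n d (\<lambda>t. F (Node (repl d t ts2)) k)) +
       (\<Sum>w\<in>fset ts - {u}. measure_pmf.expectation P
         (\<lambda>k. ins_sum \<alpha> \<gamma> n w (\<lambda>t. F (Node (repl w t ts2)) k))))"
      unfolding ins_sum_Node[OF p2] c2 sum.remove[OF finite_fset fset2(2)] fset2(1)
      by (simp add: int del: finsert_fminus_single)
    moreover have "ins_sum \<alpha> \<gamma> n (Node ts)
       (\<lambda>t. measure_pmf.expectation (swap_law \<alpha> \<gamma> b t i) (F (delete_leaf i t))) =
      \<gamma> * measure_pmf.expectation P (F (Node {|Leaf n, Node ts2|})) +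
      ((real (fcard ts) - 1) * \<alpha> - \<gamma>) * measure_pmf.expectation P (F (Node (finsert (Leaf n) ts2))) +
      (F (map_ltree (Transposition.transpose i n) (Node ts)) n +
        measure_pmf.expectation P (\<lambda>k. ins_sum \<alpha> \<gamma> n d (\<lambda>t. F (Node (repl d t ts2)) k)) +
       (\<Sum>w\<in>fset ts - {u}. measure_pmf.expectation P
         (\<lambda>k. ins_sum \<alpha> \<gamma> n w (\<lambda>t. F (Node (repl w t ts2)) k))))"
      unfolding ins_sum_Node[OF ts] branch swap_law_edge[OF ts Node.prems(1,2) fr]
        delete_leaf_edge[OF ts Node.prems(1,2) fr] P del sum.remove[OF finite_fset deep(1)] own
      by (simp add: sibling del: finsert_fminus_single)
    ultimately show ?thesis unfolding P del by simp
  qed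
qed auto

section \<open>Removal of the inserted leaf\<close>

text \<open>When the new leaf is selected, it is exchanged with itself: it is the maximum of the
  compared labels if its parent has two children, and last in the order otherwise. No averaging over
  the sites is involved; \<open>b \<le> n\<close> keeps the outside label from winning the
  maximum.\<close>

lemma swap_delete_inserted:
  fixes F :: "nat ltree \<Rightarrow> nat \<Rightarrow> real"
  assumes params: "0 \<le> \<gamma>" "\<gamma> \<le> \<alpha>"
    and "proper_tree s" "\<And>l. l \<in> leaves s \<Longrightarrow> l < n" "x \<in> ins s" "b \<le> n"
  shows "measure_pmf.expectation (swap_law \<alpha> \<gamma> b (insert_leaf n x s) n)
     (F (delete_leaf n (insert_leaf n x s))) = F s n"
  using assms(3-)
proof (induction s arbitrary: b F rule: proper_tree_induct)
  case (Leaf i)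
  then have x: "x = Edge (Leaf i)" and i: "i < n" by (auto simp: ins_Leaf)
  have p: "proper_tree (Node {|Leaf n, Leaf i|})"
    using i by (intro proper_tree_Node_insert) (auto intro: proper_tree.intros)
  have "swap_law \<alpha> \<gamma> b (Node {|Leaf n, Leaf i|}) n = return_pmf n"
    using swap_law_child[OF p, of n] local_swap_cherry(2)[OF i Leaf(3)] by simp
  moreover have "delete_leaf n (Node {|Leaf n, Leaf i|}) = Leaf i"
    using delete_leaf_pair[OF p] i by simp
  ultimately show ?case unfolding x insert_leaf_Edge_self by simp
next
  case (Node ts)
  note ts = Node.hyps and lt_n = Node.prems(1)
  have fr: "n \<notin> leaves (Node ts)" using lt_n by blast
  consider (edge) "x = Edge (Node ts)" | (branch) "x = Branch ts"
    | (child) u where "u |\<in>| ts" "x \<in> ins u"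
    using Node.prems(2) by (auto simp: ins_Node)
  then show ?case
  proof cases
    case edge
    note p = proper_tree_Node_insert[OF ts fr]
    have c: "fcard {|Leaf n, Node ts|} = 2" by (simp add: fcard.rep_eq)
    have "{Leaf n, Node ts} - {Leaf n} = {Node ts}" by auto
    moreover have "least_label {Node ts} < n" using lt_n least_label_in[OF ts] by blast
    ultimately have "local_swap \<alpha> \<gamma> {|Leaf n, Node ts|} b n = return_pmf n"
      using c Node.prems(3) by (simp add: local_swap_def max_def)
    then have "swap_law \<alpha> \<gamma> b (Node {|Leaf n, Node ts|}) n = return_pmf n"
      using swap_law_child[OF p, of n] by simp
    moreover have "delete_leaf n (Node {|Leaf n, Node ts|}) = Node ts"
      using delete_leaf_pair[OF p] by simp
    ultimately show ?thesis unfolding edge insert_leaf_Edge_self by simp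
  next
    case branch
    note p = proper_tree_finsert_Leaf[OF ts fr]
    have c: "Leaf n |\<in>| finsert (Leaf n) ts" by simp
    have "finsert (Leaf n) ts |-| {|Leaf n|} = ts" using fr by auto
    moreover have "fcard (finsert (Leaf n) ts) \<noteq> 2" using p(2) ts by (simp add: proper_tree_Node_iff)
    ultimately have "delete_leaf n (Node (finsert (Leaf n) ts)) = Node ts"
      using delete_leaf_child[OF p(1) c] by (simp del: finsert_fminus_single)
    then show ?thesis
      using swap_law_child[OF p(1) c] expectation_local_swap_finsert_self[OF params ts lt_n]
      unfolding branch insert_leaf_Branch_self by simp
  next
    case child
    have pu: "proper_tree u" by (rule proper_tree_child[OF ts child(1)])
    have fr_u: "n \<notin> leaves u" "\<And>l. l \<in> leaves u \<Longrightarrow> l < n" using fr lt_n child(1) by auto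
    define t where "t = insert_leaf n x u"
    define b' where "b' = least_label (fset ts - {u})"
    have b': "b' \<le> n"
      using least_label_siblings_in[OF ts child(1)] lt_n by (auto simp: b'_def less_imp_le)
    have t: "proper_tree t" "leaves t = insert n (leaves u)"
      using proper_tree_insert_leaf[OF pu child(2) fr_u(1)] by (auto simp: t_def)
    note r = fresh_repl[OF ts fr child(1) t]
    have "t \<noteq> Leaf n" using t(2) fr_u leaves_nonempty[OF pu] by auto
    then have t_in: "t |\<in>| repl u t ts" "n \<in> leaves t" "t \<noteq> Leaf n" using t by auto
    have "swap_law \<alpha> \<gamma> b (Node (repl u t ts)) n = swap_law \<alpha> \<gamma> b' t n"
      using swap_law_deep[OF r(1) t_in] unfolding repl_repl(2)[OF r(2)] b'_def .
    moreover have "delete_leaf n (Node (repl u t ts)) = Node (repl u (delete_leaf n t) ts)"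
      using delete_leaf_deep[OF r(1) t_in] unfolding repl_repl(1)[OF r(2)] .
    moreover have "repl u u ts = ts" using child(1) by auto
    ultimately show ?thesis
      using Node.IH[OF child(1) fr_u(2) child(2) b', of "\<lambda>t. F (Node (repl u t ts))"]
      unfolding insert_leaf_deep[OF ts child] t_def[symmetric] by (simp del: finsert_fminus_single)
  qed
qed

lemma expectation_bind_finite:
  fixes h :: "'b \<Rightarrow> real"
  assumes "finite (set_pmf p)" "\<And>x. x \<in> set_pmf p \<Longrightarrow> finite (set_pmf (f x))"
  shows "measure_pmf.expectation (bind_pmf p f) h =
    measure_pmf.expectation p (\<lambda>x. measure_pmf.expectation (f x) h)"
  using pmf_expectation_bind[OF assms order_refl, where h = h]
    integral_measure_pmf[OF assms(1), where f = "\<lambda>x. measure_pmf.expectation (f x) h"]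
  by simp

lemma expectation_cong_pmf:
  fixes f :: "'a \<Rightarrow> real"
  assumes "\<And>x. x \<in> set_pmf p \<Longrightarrow> f x = g x"
  shows "measure_pmf.expectation p f = measure_pmf.expectation p g"
  using assms by (intro integral_cong_AE) (auto simp: AE_measure_pmf_iff)

section \<open>Trees on small label sets\<close>

lemma trees_singleton: "trees {a} = {Leaf a}"
proof -
  have "t = Leaf a" if "proper_tree t" "leaves t = {a}" for t
  proof (cases t)
    case (Node ts)
    have "a \<in> leaves (Node ts)" using that Node by simp
    then obtain u where u: "u |\<in>| ts" by auto
    then have "leaves u \<subset> {a}" "leaves u \<noteq> {}"
      using leaves_child_psubset[of ts u] leaves_nonempty[of u] proper_tree_child[of ts u] that Node
      by auto
    then show ?thesis by blast
  qed (use that in auto)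
  then show ?thesis by (auto simp: trees_def intro: proper_tree.intros)
qed

lemma trees_pair:
  assumes "a \<noteq> b"
  shows "trees {a, b} \<subseteq> {Node {|Leaf a, Leaf b|}}"
proof
  fix t assume "t \<in> trees {a, b}"
  then have t: "proper_tree t" "leaves t = {a, b}" by (auto simp: trees_def)
  show "t \<in> {Node {|Leaf a, Leaf b|}}"
  proof (cases t)
    case (Leaf i)
    then show ?thesis using t assms by auto
  next
    case (Node ts)
    have "u \<in> {Leaf a, Leaf b}" if u: "u |\<in>| ts" for u
    proof -
      have "leaves u \<subset> {a, b}" "leaves u \<noteq> {}" "proper_tree u"
        using leaves_child_psubset[of ts u] leaves_nonempty[of u] proper_tree_child[of ts u] t Node u
        by auto
      then have "u \<in> trees {a} \<or> u \<in> trees {b}" unfolding trees_def by blast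
      then show ?thesis by (auto simp: trees_singleton)
    qed
    then have "fset ts \<subseteq> {Leaf a, Leaf b}" by blast
    moreover have "card {Leaf a, Leaf b} \<le> card (fset ts)"
      using t Node assms by (simp add: proper_tree_Node_iff fcard.rep_eq)
    ultimately have "fset ts = {Leaf a, Leaf b}" by (intro card_seteq) auto
    then have "ts = {|Leaf a, Leaf b|}" by (intro fset_eqI) auto
    then show ?thesis using Node by simp
  qed
qed

text \<open>The children of a branch point have strictly smaller label sets, so a tree is a leaf or
  a set of trees from a collection that is finite by induction.\<close>

lemma finite_trees: "finite A \<Longrightarrow> finite (trees A)"
proof (induction A rule: finite_psubset_induct)
  case (psubset A)
  define U where "U = (\<Union>B\<in>{B. B \<subset> A}. trees B)"
  have "finite {B. B \<subset> A}" using psubset.hyps by (auto intro: finite_subset[of _ "Pow A"])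
  then have "finite U" unfolding U_def using psubset.IH by auto
  moreover have "trees A \<subseteq> Leaf ` A \<union> Node ` {ts. fset ts \<subseteq> U}"
  proof
    fix t assume t: "t \<in> trees A"
    show "t \<in> Leaf ` A \<union> Node ` {ts. fset ts \<subseteq> U}"
    proof (cases t)
      case (Node ts)
      have "u \<in> U" if "u |\<in>| ts" for u
        using leaves_child_psubset[of ts u] proper_tree_child[of ts u] that t Node
        by (auto simp: U_def trees_def)
      then show ?thesis using Node by auto
    qed (use t in \<open>auto simp: trees_def\<close>)
  qed
  moreover have "finite {ts. fset ts \<subseteq> U}"
  proof (rule finite_imageD)
    show "finite (fset ` {ts. fset ts \<subseteq> U})"
      using \<open>finite U\<close> by (auto intro: finite_subset[of _ "Pow U"])
    show "inj_on fset {ts. fset ts \<subseteq> U}" by (simp add: inj_on_def fset_inject)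
  qed
  ultimately show ?case using psubset.hyps by (auto intro: finite_subset)
qed

lemma trees_atLeastAtMost:
  fixes t :: "nat ltree"
  assumes "2 \<le> n" "t \<in> trees {1..n}" "i \<in> {1..n}"
  shows "proper_tree t" "i \<in> leaves t" "t \<noteq> Leaf i"
proof -
  have "1 \<in> leaves t" "2 \<in> leaves t" using assms by (auto simp: trees_def)
  then show "t \<noteq> Leaf i" by auto
qed (use assms in \<open>auto simp: trees_def\<close>)

section \<open>Growth and deletion as operators\<close>

context
  fixes \<alpha> \<gamma> :: real
  assumes params: "0 \<le> \<gamma>" "\<gamma> \<le> \<alpha>" "\<alpha> \<le> 1"
begin

lemma weight_nonneg:
  assumes "proper_tree s" "x \<in> ins s"
  shows "0 \<le> weight \<alpha> \<gamma> x"
proof (cases x)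
  case (Branch ts)
  have "proper_tree (Node ts)" using assms Branch by (auto simp: ins_iff intro: proper_tree_subtrees)
  then have "1 * \<alpha> \<le> (real (fcard ts) - 1) * \<alpha>"
    using params by (intro mult_right_mono) (auto simp: proper_tree_Node_iff)
  then show ?thesis using params Branch by simp
qed (use params in auto)

text \<open>In multiplied form the identity includes \<open>m = 1\<close>: both sides are 1 -
  \<alpha> times the value at the two-leaf tree, even if \<alpha> = 1 and the growth step is
  prescribed separately.\<close>

lemma
  assumes "1 \<le> m" "s \<in> trees {1..m}"
  shows expectation_growth_step:
      "(real m - \<alpha>) * measure_pmf.expectation (growth_step \<alpha> \<gamma> m s) f = ins_sum \<alpha> \<gamma> (Suc m) s f"
    and set_growth_step: "set_pmf (growth_step \<alpha> \<gamma> m s) \<subseteq> trees {1..Suc m}"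
proof -
  have s: "proper_tree s" "leaves s = {1..m}" using assms(2) by (auto simp: trees_def)
  have ins: "insert_leaf (Suc m) x s \<in> trees {1..Suc m}" if "x \<in> ins s" for x
    using proper_tree_insert_leaf[OF s(1) that, of "Suc m"] s
    by (auto simp: trees_def atLeastAtMostSuc_conv)
  have "(real m - \<alpha>) * measure_pmf.expectation (growth_step \<alpha> \<gamma> m s) f = ins_sum \<alpha> \<gamma> (Suc m) s f
    \<and> set_pmf (growth_step \<alpha> \<gamma> m s) \<subseteq> trees {1..Suc m}"
  proof (cases "m = 1")
    case True
    then have "s = Leaf 1" using assms(2) trees_singleton[of "1::nat"] by (simp del: One_nat_def)
    then show ?thesis
      using True ins[of "Edge (Leaf 1)"]
      by (simp add: growth_step_def ins_sum_Leaf ins_Leaf finsert_commute numeral_2_eq_2)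
  next
    case False
    then have m: "real m - \<alpha> > 0" using assms(1) params by simp
    define f' where "f' = (\<lambda>x. if x \<in> ins s then weight \<alpha> \<gamma> x / (real m - \<alpha>) else 0)"
    have "(\<Sum>x\<in>ins s. weight \<alpha> \<gamma> x) = real m - \<alpha>"
      using ins_sum_total[OF s(1), of \<alpha> \<gamma> "Suc m"] s(2) by (simp add: ins_sum_def)
    then have "sum f' (ins s) = 1" using m by (simp add: f'_def flip: sum_divide_distrib)
    then have f': "finite (ins s)" "\<And>x. 0 \<le> f' x" "\<And>x. x \<notin> ins s \<Longrightarrow> f' x = 0" "sum f' (ins s) = 1"
      using weight_nonneg[OF s(1)] m by (auto simp: f'_def)
    have g: "growth_step \<alpha> \<gamma> m s = map_pmf (\<lambda>x. insert_leaf (Suc m) x s) (embed_pmf f')"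
      using False by (simp add: growth_step_def f'_def)
    have "measure_pmf.expectation (growth_step \<alpha> \<gamma> m s) f = (\<Sum>x\<in>ins s. f' x * f (insert_leaf (Suc m) x s))"
      unfolding g integral_map_pmf by (rule expectation_embed_pmf_finite[OF f'])
    also have "(real m - \<alpha>) * \<dots> = ins_sum \<alpha> \<gamma> (Suc m) s f"
      unfolding ins_sum_def sum_distrib_left using m by (intro sum.cong) (auto simp: f'_def)
    finally show ?thesis using set_embed_pmf_finite[OF f'] ins by (auto simp: g)
  qed
  then show "(real m - \<alpha>) * measure_pmf.expectation (growth_step \<alpha> \<gamma> m s) f = ins_sum \<alpha> \<gamma> (Suc m) s f"
    "set_pmf (growth_step \<alpha> \<gamma> m s) \<subseteq> trees {1..Suc m}" by auto
qed

lemma set_swap_label: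
  assumes "2 \<le> n" "t \<in> trees {1..n}" "i \<in> {1..n}"
  shows "set_pmf (swap_label \<alpha> \<gamma> t i) \<subseteq> {1..n}"
proof -
  note t = trees_atLeastAtMost[OF assms(1-3)]
  show ?thesis
    using set_swap_law_subset[OF t params(1,2), of _ 0] swap_label_eq[OF t] assms
    by (auto simp: trees_def)
qed

end

text \<open>Swapping the labels \<open>i\<close> and \<open>k\<close> and deleting \<open>k\<close> amounts to deleting \<open>i\<close> and
  renaming \<open>k\<close> to \<open>i\<close>.\<close>

definition relabel :: "nat \<Rightarrow> nat \<Rightarrow> nat \<Rightarrow> nat" where
  "relabel i k = (\<lambda>l. if k < l then l - 1 else l) \<circ> Transposition.transpose i k"

definition down_tree :: "nat \<Rightarrow> nat \<Rightarrow> nat ltree \<Rightarrow> nat ltree" where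
  "down_tree i k t = map_ltree (relabel i k) (delete_leaf i t)"

lemma down_tree_eq:
  assumes "proper_tree t" "i \<in> leaves t" "t \<noteq> Leaf i"
  shows "map_ltree (\<lambda>l. if k < l then l - 1 else l)
      (delete_leaf k (map_ltree (Transposition.transpose i k) t)) = down_tree i k t"
proof -
  have "delete_leaf (Transposition.transpose i k i) (map_ltree (Transposition.transpose i k) t) =
      map_ltree (Transposition.transpose i k) (delete_leaf i t)"
    by (intro delete_leaf_map assms inj_on_subset[OF inj_on_transpose]) auto
  then show ?thesis by (simp add: down_tree_def relabel_def ltree.map_comp)
qed

lemma
  assumes "i \<in> {1..n}" "k \<in> {1..n}"
  shows inj_on_relabel: "inj_on (relabel i k) ({1..n} - {i})"
    and relabel_image: "relabel i k ` ({1..n} - {i}) = {1..n - 1}"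
proof -
  have 1: "Transposition.transpose i k ` ({1..n} - {i}) = {1..n} - {k}"
    using assms by (subst inj_on_image_set_diff[OF inj_on_transpose]) auto
  have inj: "inj_on (\<lambda>l. if k < l then l - 1 else l) ({1..n} - {k})" 
    by (auto simp: inj_on_def)
  show "inj_on (relabel i k) ({1..n} - {i})"
    unfolding relabel_def using inj 1 by (intro comp_inj_on) auto
  have "(\<lambda>l. if k < l then l - 1 else l) ` ({1..n} - {k}) = {1..n - 1}"
  proof (rule card_seteq)
    show "(\<lambda>l. if k < l then l - 1 else l) ` ({1..n} - {k}) \<subseteq> {1..n - 1}" using assms by auto
    show "card {1..n - 1} \<le> card ((\<lambda>l. if k < l then l - 1 else l) ` ({1..n} - {k}))"
      using assms by (subst card_image[OF inj]) simp
  qed auto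
  then show "relabel i k ` ({1..n} - {i}) = {1..n - 1}"
    unfolding relabel_def image_comp[symmetric] 1 .
qed

lemma down_tree_in_trees:
  assumes "2 \<le> n" "t \<in> trees {1..n}" "i \<in> {1..n}" "k \<in> {1..n}"
  shows "down_tree i k t \<in> trees {1..n - 1}"
proof -
  note t = trees_atLeastAtMost[OF assms(1-3)]
  have "leaves t = {1..n}" using assms by (simp add: trees_def)
  then show ?thesis
    using proper_tree_delete_leaf[OF t] proper_tree_map[of "delete_leaf i t" "relabel i k"]
      inj_on_relabel[OF assms(3,4)] relabel_image[OF assms(3,4)]
    by (simp add: down_tree_def trees_def ltree.set_map)
qed

text \<open>Transition operators act on functions of the final state, so in a composition the outer
  operator belongs to the step taken first.\<close>

definition down_op :: "real \<Rightarrow> real \<Rightarrow> nat \<Rightarrow> (nat ltree \<Rightarrow> real) \<Rightarrow> nat ltree \<Rightarrow> real" where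
  "down_op \<alpha> \<gamma> n g t =
    (\<Sum>i=1..n. measure_pmf.expectation (swap_label \<alpha> \<gamma> t i) (\<lambda>k. g (down_tree i k t))) / real n"

definition growth_op :: "real \<Rightarrow> real \<Rightarrow> nat \<Rightarrow> (nat ltree \<Rightarrow> real) \<Rightarrow> nat ltree \<Rightarrow> real" where
  "growth_op \<alpha> \<gamma> n g t = measure_pmf.expectation (growth_step \<alpha> \<gamma> n t) g"

definition chain_op :: "real \<Rightarrow> real \<Rightarrow> nat \<Rightarrow> (nat ltree \<Rightarrow> real) \<Rightarrow> nat ltree \<Rightarrow> real" where
  "chain_op \<alpha> \<gamma> n g t = measure_pmf.expectation (chain_step \<alpha> \<gamma> n t) g"

context
  fixes \<alpha> \<gamma> :: real
  assumes params: "0 \<le> \<gamma>" "\<gamma> \<le> \<alpha>" "\<alpha> \<le> 1"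
begin

lemma chain_step_eq:
  assumes "2 \<le> n" "t \<in> trees {1..n}"
  shows "chain_step \<alpha> \<gamma> n t = bind_pmf (pmf_of_set {1..n}) (\<lambda>i.
    bind_pmf (swap_label \<alpha> \<gamma> t i) (\<lambda>k. growth_step \<alpha> \<gamma> (n - 1) (down_tree i k t)))"
proof -
  have "map_ltree (\<lambda>l. if k < l then l - 1 else l)
      (delete_leaf k (map_ltree (Transposition.transpose i k) t)) = down_tree i k t"
    if "i \<in> set_pmf (pmf_of_set {1..n})" for i k
    using that assms(1) trees_atLeastAtMost[OF assms, of i] by (intro down_tree_eq) (auto simp: set_pmf_of_set)
  then show ?thesis
    using assms(1) unfolding chain_step_def Let_def by (auto intro!: bind_pmf_cong)
qed

lemma set_chain_step:
  assumes "1 \<le> n" "t \<in> trees {1..n}"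
  shows "set_pmf (chain_step \<alpha> \<gamma> n t) \<subseteq> trees {1..n}"
proof (cases "n = 1")
  case False
  then have n: "2 \<le> n" using assms by simp
  have "set_pmf (growth_step \<alpha> \<gamma> (n - 1) (down_tree i k t)) \<subseteq> trees {1..n}"
    if "i \<in> {1..n}" "k \<in> set_pmf (swap_label \<alpha> \<gamma> t i)" for i k
  proof -
    have "k \<in> {1..n}" using set_swap_label[OF params n assms(2) that(1)] that(2) by blast
    then show ?thesis
      using set_growth_step[OF params _ down_tree_in_trees[OF n assms(2) that(1)]] n by simp
  qed
  then show ?thesis
    unfolding chain_step_eq[OF n assms(2)] using n by (simp add: set_pmf_of_set UN_subset_iff)
qed (use assms in \<open>simp add: chain_step_def\<close>)

lemma chain_op_eq:
  assumes "2 \<le> n" "t \<in> trees {1..n}"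
  shows "chain_op \<alpha> \<gamma> n f t = down_op \<alpha> \<gamma> n (growth_op \<alpha> \<gamma> (n - 1) f) t"
proof -
  have fin1: "finite (set_pmf (swap_label \<alpha> \<gamma> t i))" if "i \<in> {1..n}" for i
    using set_swap_label[OF params assms that] by (rule finite_subset) simp
  have fin2: "finite (set_pmf (growth_step \<alpha> \<gamma> (n - 1) (down_tree i k t)))"
    if "i \<in> {1..n}" "k \<in> set_pmf (swap_label \<alpha> \<gamma> t i)" for i k
  proof (rule finite_subset)
    show "set_pmf (growth_step \<alpha> \<gamma> (n - 1) (down_tree i k t)) \<subseteq> trees {1..Suc (n - 1)}"
      using set_swap_label[OF params assms that(1)] that assms(1)
      by (intro set_growth_step[OF params] down_tree_in_trees[OF assms that(1)]) auto
  qed (rule finite_trees, simp)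
  have "measure_pmf.expectation (chain_step \<alpha> \<gamma> n t) f = measure_pmf.expectation (pmf_of_set {1..n})
      (\<lambda>i. measure_pmf.expectation (bind_pmf (swap_label \<alpha> \<gamma> t i)
        (\<lambda>k. growth_step \<alpha> \<gamma> (n - 1) (down_tree i k t))) f)"
    unfolding chain_step_eq[OF assms] using assms(1) fin1 fin2
    by (intro expectation_bind_finite) (auto simp: set_pmf_of_set)
  also have "\<dots> = measure_pmf.expectation (pmf_of_set {1..n})
      (\<lambda>i. measure_pmf.expectation (swap_label \<alpha> \<gamma> t i)
        (\<lambda>k. growth_op \<alpha> \<gamma> (n - 1) f (down_tree i k t)))"
    unfolding growth_op_def using assms(1) fin1 fin2
    by (intro expectation_cong_pmf expectation_bind_finite) (auto simp: set_pmf_of_set)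
  also have "\<dots> = down_op \<alpha> \<gamma> n (growth_op \<alpha> \<gamma> (n - 1) f) t"
    using assms(1) by (simp add: down_op_def integral_pmf_of_set)
  finally show ?thesis by (simp add: chain_op_def)
qed

lemma down_op_cong:
  assumes "2 \<le> n" "t \<in> trees {1..n}" "\<And>s. s \<in> trees {1..n - 1} \<Longrightarrow> f s = g s"
  shows "down_op \<alpha> \<gamma> n f t = down_op \<alpha> \<gamma> n g t"
  unfolding down_op_def
  using set_swap_label[OF params assms(1,2)] down_tree_in_trees[OF assms(1,2)] assms(3)
  by (intro arg_cong2[of _ _ _ _ "(/)"] sum.cong refl expectation_cong_pmf) blast

lemma down_op_const:
  assumes "2 \<le> n"
  shows "down_op \<alpha> \<gamma> n (\<lambda>_. c) t = c"
  using assms by (simp add: down_op_def)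

lemma growth_op_cong:
  assumes "1 \<le> n" "t \<in> trees {1..n}" "\<And>s. s \<in> trees {1..Suc n} \<Longrightarrow> f s = g s"
  shows "growth_op \<alpha> \<gamma> n f t = growth_op \<alpha> \<gamma> n g t"
  unfolding growth_op_def
  using set_growth_step[OF params assms(1,2)] assms(3) by (intro expectation_cong_pmf) blast

lemma chain_op_cong:
  assumes "1 \<le> n" "t \<in> trees {1..n}" "\<And>s. s \<in> trees {1..n} \<Longrightarrow> f s = g s"
  shows "chain_op \<alpha> \<gamma> n f t = chain_op \<alpha> \<gamma> n g t"
  unfolding chain_op_def
  using set_chain_step[OF assms(1,2)] assms(3) by (intro expectation_cong_pmf) blast

lemma chain_op_linear:
  assumes "1 \<le> n" "t \<in> trees {1..n}"
  shows "chain_op \<alpha> \<gamma> n (\<lambda>s. a * f s + b * g s) t = a * chain_op \<alpha> \<gamma> n f t + b * chain_op \<alpha> \<gamma> n g t"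
proof -
  have "finite (set_pmf (chain_step \<alpha> \<gamma> n t))"
    using set_chain_step[OF assms] by (rule finite_subset) (simp add: finite_trees)
  then have "integrable (measure_pmf (chain_step \<alpha> \<gamma> n t)) h" for h :: "nat ltree \<Rightarrow> real"
    by (rule integrable_measure_pmf_finite)
  then show ?thesis unfolding chain_op_def by simp
qed

text \<open>Of the total mass \<open>(m + 1) * (m - \<alpha>)\<close> over selected leaves and
  weighted sites, each of the \<open>m\<close> old leaves returns 1 to \<open>s\<close> and the new
  leaf returns \<open>m - \<alpha>\<close>; the ratio is \<open>p\<close>. What remains for an old
  leaf is a growth step from \<open>m - 1\<close> leaves of mass
  \<open>m - 1 - \<alpha>\<close>.\<close>

lemma growth_down_commute:
  assumes "2 \<le> m" "s \<in> trees {1..m}"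
  defines "p \<equiv> (1 + real m / (real m - \<alpha>)) / (real m + 1)"
  shows "growth_op \<alpha> \<gamma> m (down_op \<alpha> \<gamma> (Suc m) g) s = p * g s + (1 - p) * chain_op \<alpha> \<gamma> m g s"
proof -
  define n where "n = Suc m"
  have s: "proper_tree s" "leaves s = {1..m}" using assms(2) by (auto simp: trees_def)
  have m: "real m - \<alpha> > 0" using assms(1) params by simp
  have n: "n \<notin> leaves s" "\<And>l. l \<in> leaves s \<Longrightarrow> l < n" using s by (auto simp: n_def)
  define A where "A i t = measure_pmf.expectation (swap_law \<alpha> \<gamma> 0 t i) (\<lambda>k. g (down_tree i k t))" for i t
  have "ins_sum \<alpha> \<gamma> n s (down_op \<alpha> \<gamma> n g) = ins_sum \<alpha> \<gamma> n s (\<lambda>t. \<Sum>i=1..n. A i t / real n)"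
  proof (rule ins_sum_cong[OF s(1) n(1)])
    fix t assume t: "proper_tree t" "leaves t = insert n (leaves s)"
    have "swap_label \<alpha> \<gamma> t i = swap_law \<alpha> \<gamma> 0 t i" if "i \<in> {1..n}" for i
    proof (rule swap_label_eq[OF t(1)])
      have l: "leaves t = {1..n}" using t s by (auto simp: n_def)
      then show "i \<in> leaves t" using that by simp
      have "1 \<in> leaves t" "2 \<in> leaves t" using l assms(1) by (auto simp: n_def)
      then show "t \<noteq> Leaf i" by auto
    qed
    then show "down_op \<alpha> \<gamma> n g t = (\<Sum>i=1..n. A i t / real n)"
      by (simp add: down_op_def A_def sum_divide_distrib)
  qed
  also have "\<dots> = (\<Sum>i=1..n. ins_sum \<alpha> \<gamma> n s (A i)) / real n"
    unfolding ins_sum_sum sum_divide_distrib by (simp add: ins_sum_def sum_divide_distrib)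
  also have "(\<Sum>i=1..n. ins_sum \<alpha> \<gamma> n s (A i)) = (\<Sum>i=1..m. ins_sum \<alpha> \<gamma> n s (A i)) + ins_sum \<alpha> \<gamma> n s (A n)"
    by (simp add: n_def)
  also have "ins_sum \<alpha> \<gamma> n s (A n) = (real m - \<alpha>) * g s"
  proof -
    \<comment> \<open>For \<open>i = n\<close> the transposition is trivial, and no label of
      \<open>s\<close> lies above \<open>n\<close>, so there is no gap to close.\<close>
    have "map_ltree (relabel n n) s = s"
      using n(2) by (intro ltree.map_ident_strong) (fastforce simp: relabel_def)
    then have "A n (insert_leaf n x s) = g s" if "x \<in> ins s" for x
      using swap_delete_inserted[OF params(1,2) s(1) n(2) that,
          where b = 0 and F = "\<lambda>t k. g (map_ltree (relabel n k) t)"]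
      by (simp add: A_def down_tree_def)
    then have "ins_sum \<alpha> \<gamma> n s (A n) = ins_sum \<alpha> \<gamma> n s (\<lambda>_. g s)"
      unfolding ins_sum_def by (intro sum.cong) auto
    then show ?thesis using ins_sum_total[OF s(1), of \<alpha> \<gamma> n] s(2) ins_sum_const[of \<alpha> \<gamma> n s "g s"] by simp
  qed
  also have "(\<Sum>i=1..m. ins_sum \<alpha> \<gamma> n s (A i)) =
      (\<Sum>i=1..m. g s + (real m - 1 - \<alpha>) * measure_pmf.expectation (swap_label \<alpha> \<gamma> s i)
        (\<lambda>k. growth_op \<alpha> \<gamma> (m - 1) g (down_tree i k s)))"
  proof (intro sum.cong refl)
    fix i assume i: "i \<in> {1..m}"
    note si = trees_atLeastAtMost(2,3)[OF assms(1,2) i]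
    have "ins_sum \<alpha> \<gamma> n s (A i) =
        g (map_ltree (relabel i n) (map_ltree (Transposition.transpose i n) s)) +
        measure_pmf.expectation (swap_law \<alpha> \<gamma> 0 s i)
         (\<lambda>k. ins_sum \<alpha> \<gamma> n (delete_leaf i s) (\<lambda>t. g (map_ltree (relabel i k) t)))"
      using ins_sum_swap[OF params(1,2) s(1) si n(2),
          where b = 0 and F = "\<lambda>t k. g (map_ltree (relabel i k) t)"]
      unfolding A_def down_tree_def .
    \<comment> \<open>The two transpositions cancel, and no label of \<open>s\<close> is above
      \<open>n\<close>: the down step has returned to \<open>s\<close>.\<close>
    also have "map_ltree (relabel i n) (map_ltree (Transposition.transpose i n) s) = s"
      unfolding ltree.map_comp using n(2)
      by (intro ltree.map_ident_strong) (fastforce simp: relabel_def)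
    also have "measure_pmf.expectation (swap_law \<alpha> \<gamma> 0 s i)
         (\<lambda>k. ins_sum \<alpha> \<gamma> n (delete_leaf i s) (\<lambda>t. g (map_ltree (relabel i k) t))) =
        measure_pmf.expectation (swap_label \<alpha> \<gamma> s i)
         (\<lambda>k. (real m - 1 - \<alpha>) * growth_op \<alpha> \<gamma> (m - 1) g (down_tree i k s))"
      unfolding swap_label_eq[OF s(1) si]
    proof (rule expectation_cong_pmf)
      fix k assume "k \<in> set_pmf (swap_law \<alpha> \<gamma> 0 s i)"
      then have k: "k \<in> {1..m}"
        using set_swap_label[OF params assms(1,2) i] swap_label_eq[OF s(1) si] by auto
      have d: "proper_tree (delete_leaf i s)" "leaves (delete_leaf i s) = {1..m} - {i}"
        using proper_tree_delete_leaf[OF s(1) si] s by auto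
      \<comment> \<open>Here \<open>n\<close> is inserted into a tree whose labels have a gap at
        \<open>i\<close>. The relabelling closes the gap and sends \<open>n\<close> to
        \<open>m\<close>, which makes this the growth step from \<open>m - 1\<close> to
        \<open>m\<close> leaves.\<close>
      have "insert n ({1..m} - {i}) = {1..n} - {i}" using i by (auto simp: n_def)
      moreover have "inj_on (relabel i k) ({1..n} - {i})"
        by (rule inj_on_relabel) (use i k in \<open>auto simp: n_def\<close>)
      moreover have "relabel i k n = m" using i k by (auto simp: relabel_def n_def)
      ultimately have "ins_sum \<alpha> \<gamma> n (delete_leaf i s) (\<lambda>t. g (map_ltree (relabel i k) t)) =
          ins_sum \<alpha> \<gamma> m (down_tree i k s) g"
        using ins_sum_map[OF d(1), of n "relabel i k" \<alpha> \<gamma> g] d(2) by (simp add: n_def down_tree_def)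
      also have "\<dots> = (real m - 1 - \<alpha>) * growth_op \<alpha> \<gamma> (m - 1) g (down_tree i k s)"
        using expectation_growth_step[OF params, of "m - 1" "down_tree i k s" g] assms(1)
          down_tree_in_trees[OF assms(1,2) i k]
        by (simp add: growth_op_def of_nat_diff)
      finally show "ins_sum \<alpha> \<gamma> n (delete_leaf i s) (\<lambda>t. g (map_ltree (relabel i k) t)) =
          (real m - 1 - \<alpha>) * growth_op \<alpha> \<gamma> (m - 1) g (down_tree i k s)" .
    qed
    finally show "ins_sum \<alpha> \<gamma> n s (A i) = g s + (real m - 1 - \<alpha>) *
        measure_pmf.expectation (swap_label \<alpha> \<gamma> s i)
        (\<lambda>k. growth_op \<alpha> \<gamma> (m - 1) g (down_tree i k s))" by simp
  qed
  also have "\<dots> = real m * g s + (real m - 1 - \<alpha>) * (real m * chain_op \<alpha> \<gamma> m g s)"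
    using assms(1) by (simp add: chain_op_eq[OF assms(1,2)] down_op_def sum.distrib flip: sum_distrib_left)
  finally have total: "(real m - \<alpha>) * growth_op \<alpha> \<gamma> m (down_op \<alpha> \<gamma> n g) s =
      (real m * g s + (real m - 1 - \<alpha>) * (real m * chain_op \<alpha> \<gamma> m g s) + (real m - \<alpha>) * g s) / real n"
    using expectation_growth_step[OF params _ assms(2)] assms(1) by (simp add: growth_op_def n_def)
  have p: "(real m - \<alpha>) * p = (real m - \<alpha> + real m) / real n"
  proof -
    have "(real m - \<alpha>) * p = (real m - \<alpha>) * (1 + real m / (real m - \<alpha>)) / real n"
      by (simp add: p_def n_def add.commute)
    also have "(real m - \<alpha>) * (1 + real m / (real m - \<alpha>)) = real m - \<alpha> + real m"
      using m by (simp add: distrib_left)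
    finally show ?thesis .
  qed
  have q: "(real m - \<alpha>) * (1 - p) = (real m - 1 - \<alpha>) * real m / real n"
    using p by (simp add: right_diff_distrib) (simp add: n_def field_simps)
  have "(real m - \<alpha>) * growth_op \<alpha> \<gamma> m (down_op \<alpha> \<gamma> n g) s =
      ((real m - \<alpha>) * p) * g s + ((real m - \<alpha>) * (1 - p)) * chain_op \<alpha> \<gamma> m g s"
    unfolding total p q by (simp add: add_divide_distrib diff_divide_distrib algebra_simps)
  also have "\<dots> = (real m - \<alpha>) * (p * g s + (1 - p) * chain_op \<alpha> \<gamma> m g s)"
    by (simp add: algebra_simps)
  finally show ?thesis using m by (simp add: n_def)
qed

end

section \<open>Convergence of the iterated chain\<close>

text \<open>From the index on where the input is bounded by \<open>a\<close>, the influence of the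
  past decays like \<open>p ^ q\<close>; the strict inequality \<open>a < e\<close> absorbs
  it.\<close>

lemma eventually_le_of_affine_recurrence:
  fixes y z :: "nat \<Rightarrow> real"
  assumes "0 \<le> p" "p < 1" "\<And>r. y (Suc r) = p * y r + (1 - p) * z r"
    and z: "\<forall>\<^sub>F r in sequentially. \<bar>z r\<bar> \<le> a" and "a < e"
  shows "\<forall>\<^sub>F r in sequentially. \<bar>y r\<bar> \<le> e"
proof -
  obtain R where R: "\<And>r. r \<ge> R \<Longrightarrow> \<bar>z r\<bar> \<le> a" using z by (auto simp: eventually_sequentially)
  have bound: "\<bar>y (R + q)\<bar> \<le> a + p ^ q * \<bar>y R\<bar>" for q
  proof (induction q)
    case 0
    then show ?case using R[of R] by auto
  next
    case (Suc q)
    have "\<bar>y (R + Suc q)\<bar> \<le> p * \<bar>y (R + q)\<bar> + (1 - p) * \<bar>z (R + q)\<bar>"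
      using assms(1,2) assms(3)[of "R + q"] abs_triangle_ineq[of "p * y (R + q)" "(1 - p) * z (R + q)"]
      by (simp add: abs_mult)
    also have "\<dots> \<le> p * (a + p ^ q * \<bar>y R\<bar>) + (1 - p) * a"
      using assms(1,2) Suc R[of "R + q"] by (intro add_mono mult_left_mono) auto
    finally show ?case by (simp add: algebra_simps)
  qed
  have "(\<lambda>q. a + p ^ q * \<bar>y R\<bar>) \<longlonglongrightarrow> a + 0 * \<bar>y R\<bar>"
    using assms(1,2) by (intro tendsto_intros LIMSEQ_power_zero) auto
  then have "\<forall>\<^sub>F q in sequentially. a + p ^ q * \<bar>y R\<bar> < e"
    using \<open>a < e\<close> by (auto dest: order_tendstoD(2))
  then have "\<forall>\<^sub>F q in sequentially. \<bar>y (q + R)\<bar> \<le> e"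
    by eventually_elim (use bound in \<open>auto simp: add.commute intro: order_trans less_imp_le\<close>)
  then show ?thesis by (rule eventually_sequentially_seg[of "\<lambda>r. \<bar>y r\<bar> \<le> e" R, THEN iffD1])
qed

text \<open>Each row is a convex combination of the previous row and its shift. Entries far to the
  right are small in the first row, hence in all rows; every column is an affine recurrence driven
  by its right neighbour, so smallness spreads leftwards through finitely many columns.\<close>

lemma lazy_array_tendsto_0:
  fixes x :: "nat \<Rightarrow> nat \<Rightarrow> real"
  assumes p: "0 \<le> p" "p < 1" and step: "\<And>r j. x (Suc r) j = p * x r j + (1 - p) * x r (Suc j)"
    and lim: "x 0 \<longlonglongrightarrow> 0"
  shows "(\<lambda>r. x r j) \<longlonglongrightarrow> 0"
proof -
  have "\<forall>\<^sub>F r in sequentially. \<bar>x r j\<bar> \<le> e" if "e > 0" for e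
  proof -
    have "e / 2 > 0" using \<open>e > 0\<close> by simp
    then obtain J where "\<forall>i\<ge>J. norm (x 0 i - 0) < e / 2" using LIMSEQ_D[OF lim] by blast
    then have J: "\<bar>x 0 i\<bar> \<le> e / 2" if "i \<ge> J" for i using that by (simp add: less_imp_le)
    have tail: "\<bar>x r i\<bar> \<le> e / 2" if "i \<ge> J" for r i
      using that
    proof (induction r arbitrary: i)
      case (Suc r)
      have "\<bar>x (Suc r) i\<bar> \<le> p * \<bar>x r i\<bar> + (1 - p) * \<bar>x r (Suc i)\<bar>"
        using p abs_triangle_ineq[of "p * x r i" "(1 - p) * x r (Suc i)"]
        by (simp add: step abs_mult)
      also have "\<dots> \<le> p * (e / 2) + (1 - p) * (e / 2)"
        using p Suc by (intro add_mono mult_left_mono) auto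
      finally show ?case by (simp add: algebra_simps add_divide_distrib diff_divide_distrib)
    qed (use J in auto)
    \<comment> \<open>Every passage to a column further left loses an arbitrarily small amount, so
      the claim is made for each bound above \<open>e / 2\<close> instead of for
      \<open>e / 2\<close> itself.\<close>
    have "\<forall>e'>e / 2. \<forall>\<^sub>F r in sequentially. \<bar>x r (J - k)\<bar> \<le> e'" for k
    proof (induction k)
      case 0
      show ?case
      proof (intro allI impI always_eventually)
        show "\<bar>x r (J - 0)\<bar> \<le> e'" if "e / 2 < e'" for e' r
          using tail[of J r] that by simp
      qed
    next
      case (Suc k)
      show ?case
      proof (cases "k < J")
        case True
        then have J_k: "J - k = Suc (J - Suc k)" by simp
        show ?thesis
        proof (intro allI impI)
          fix e' assume e': "e / 2 < e'"
          then have "\<forall>\<^sub>F r in sequentially. \<bar>x r (Suc (J - Suc k))\<bar> \<le> (e / 2 + e') / 2"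
            using Suc.IH[unfolded J_k, rule_format, of "(e / 2 + e') / 2"] by (simp add: field_simps)
          then show "\<forall>\<^sub>F r in sequentially. \<bar>x r (J - Suc k)\<bar> \<le> e'"
            using e' by (intro eventually_le_of_affine_recurrence[OF p, of "\<lambda>r. x r (J - Suc k)"
                "\<lambda>r. x r (Suc (J - Suc k))" "(e / 2 + e') / 2"] step) auto
        qed
      qed (use Suc in simp)
    qed
    then have "\<forall>\<^sub>F r in sequentially. \<bar>x r (J - (J - j))\<bar> \<le> e" using \<open>e > 0\<close> by simp
    moreover have "\<bar>x r j\<bar> \<le> e" if "\<not> j \<le> J" for r
      using tail[of j r] that \<open>e > 0\<close> by simp
    ultimately show ?thesis by (cases "j \<le> J") (auto intro: always_eventually)
  qed
  note bound = this
  show ?thesis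
  proof (rule tendstoI)
    fix e :: real assume "e > 0"
    then have "\<forall>\<^sub>F r in sequentially. \<bar>x r j\<bar> \<le> e / 2" by (intro bound) simp
    then show "\<forall>\<^sub>F r in sequentially. dist (x r j) 0 < e"
      by eventually_elim (use \<open>e > 0\<close> in simp)
  qed
qed

text \<open>The mixed powers \<open>K ^^ j\<close> after \<open>A ^^ r\<close> form such an array:
  its row 0 is the hypothesis, its column 0 the conclusion. The recurrence says that
  \<open>K\<close> commutes with \<open>A\<close>; linearity and congruence are required on
  \<open>S\<close> only, since the operators are controlled only at proper trees with the right
  labels.\<close>

lemma lazy_powers_tendsto:
  fixes K A :: "('s \<Rightarrow> real) \<Rightarrow> 's \<Rightarrow> real"
  assumes lin: "\<And>f g s a b. s \<in> S \<Longrightarrow> K (\<lambda>t. a * f t + b * g t) s = a * K f s + b * K g s"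
    and cong: "\<And>f g s. s \<in> S \<Longrightarrow> (\<And>t. t \<in> S \<Longrightarrow> f t = g t) \<Longrightarrow> K f s = K g s"
    and p: "0 \<le> p" "p < 1" and A: "\<And>h s. s \<in> S \<Longrightarrow> A h s = p * h s + (1 - p) * K h s"
    and "s \<in> S" and lim: "(\<lambda>r. (K ^^ r) h s) \<longlonglongrightarrow> c"
  shows "(\<lambda>r. (A ^^ r) h s) \<longlonglongrightarrow> c"
proof -
  define x where "x r j = (K ^^ j) ((A ^^ r) h) s - c" for r j
  have commute: "(K ^^ j) (A f) s = p * (K ^^ j) f s + (1 - p) * (K ^^ Suc j) f s"
    if "s \<in> S" for j f s
    using that
  proof (induction j arbitrary: s)
    case (Suc j)
    have "(K ^^ Suc j) (A f) s = K (\<lambda>s. p * (K ^^ j) f s + (1 - p) * (K ^^ Suc j) f s) s"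
      unfolding funpow.simps(2) comp_def using Suc by (intro cong) auto
    then show ?case using lin[OF Suc.prems] by simp
  qed (simp add: A)
  have "(\<lambda>r. x r 0) \<longlonglongrightarrow> 0"
  proof (rule lazy_array_tendsto_0[OF p])
    show "x (Suc r) j = p * x r j + (1 - p) * x r (Suc j)" for r j
      using commute[OF \<open>s \<in> S\<close>, of j "(A ^^ r) h"] by (simp add: x_def algebra_simps)
    have "x 0 = (\<lambda>j. (K ^^ j) h s - c)" by (simp add: x_def fun_eq_iff)
    then show "x 0 \<longlonglongrightarrow> 0" using LIM_zero[OF lim] by simp
  qed
  then show ?thesis by (simp add: x_def LIM_zero_iff)
qed

text \<open>The expectation of \<open>f (T (n + 1))\<close>.\<close>

primrec growth_mean :: "real \<Rightarrow> real \<Rightarrow> nat \<Rightarrow> (nat ltree \<Rightarrow> real) \<Rightarrow> real" where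
  "growth_mean \<alpha> \<gamma> 0 f = f (Leaf 1)"
| "growth_mean \<alpha> \<gamma> (Suc n) f = growth_mean \<alpha> \<gamma> n (growth_op \<alpha> \<gamma> (Suc n) f)"

section \<open>Induction on the number of leaves\<close>

context
  fixes \<alpha> \<gamma> :: real
  assumes params: "0 \<le> \<gamma>" "\<gamma> \<le> \<alpha>" "\<alpha> \<le> 1"
begin

lemma down_op_tendsto:
  assumes "2 \<le> n" "t \<in> trees {1..n}" "\<And>s. s \<in> trees {1..n - 1} \<Longrightarrow> (\<lambda>r. h r s) \<longlonglongrightarrow> c"
  shows "(\<lambda>r. down_op \<alpha> \<gamma> n (h r) t) \<longlonglongrightarrow> c"
proof -
  have "(\<lambda>r. measure_pmf.expectation (swap_label \<alpha> \<gamma> t i) (\<lambda>k. h r (down_tree i k t))) \<longlonglongrightarrow> c"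
    if i: "i \<in> {1..n}" for i
  proof -
    let ?q = "swap_label \<alpha> \<gamma> t i"
    have sub: "set_pmf ?q \<subseteq> {1..n}" by (rule set_swap_label[OF params assms(1,2) i])
    have E: "measure_pmf.expectation ?q f = (\<Sum>k=1..n. pmf ?q k * f k)" for f :: "nat \<Rightarrow> real"
      using sub by (subst integral_measure_pmf[of "{1..n}"]) auto
    have "(\<lambda>r. \<Sum>k=1..n. pmf ?q k * h r (down_tree i k t)) \<longlonglongrightarrow> (\<Sum>k=1..n. pmf ?q k * c)"
      by (intro tendsto_intros assms(3) down_tree_in_trees[OF assms(1,2) i])
    also have "(\<Sum>k=1..n. pmf ?q k * c) = c"
      using sum_pmf_eq_1[OF _ sub] by (simp flip: sum_distrib_right)
    finally show ?thesis unfolding E .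
  qed
  then have "(\<lambda>r. down_op \<alpha> \<gamma> n (h r) t) \<longlonglongrightarrow> (\<Sum>i=1..n. c) / real n"
    unfolding down_op_def using assms(1) by (intro tendsto_divide tendsto_sum tendsto_const) auto
  then show ?thesis using assms(1) by simp
qed

lemma chain_op_power_Suc:
  assumes "2 \<le> m" "t \<in> trees {1..Suc m}"
  shows "(chain_op \<alpha> \<gamma> (Suc m) ^^ Suc r) f t = down_op \<alpha> \<gamma> (Suc m)
    (((\<lambda>g. growth_op \<alpha> \<gamma> m (down_op \<alpha> \<gamma> (Suc m) g)) ^^ r) (growth_op \<alpha> \<gamma> m f)) t"
  using assms(2)
proof (induction r arbitrary: t)
  case 0
  then show ?case using chain_op_eq[OF params, of "Suc m" t] assms(1) by simp
next
  case (Suc r)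
  let ?K = "chain_op \<alpha> \<gamma> (Suc m)" and ?A = "\<lambda>g. growth_op \<alpha> \<gamma> m (down_op \<alpha> \<gamma> (Suc m) g)"
  have "(?K ^^ Suc (Suc r)) f t = down_op \<alpha> \<gamma> (Suc m) (growth_op \<alpha> \<gamma> m ((?K ^^ Suc r) f)) t"
    using chain_op_eq[OF params, of "Suc m" t] assms(1) Suc.prems by simp
  also have "\<dots> = down_op \<alpha> \<gamma> (Suc m) ((?A ^^ Suc r) (growth_op \<alpha> \<gamma> m f)) t"
    unfolding funpow.simps(2)[of r ?A] comp_def using assms(1) Suc
    by (intro down_op_cong[OF params] growth_op_cong[OF params]) auto
  finally show ?case .
qed

lemma trees_12:
  fixes t :: "nat ltree"
  assumes "t \<in> trees {1..2}"
  shows "t = Node {|Leaf 1, Leaf 2|}"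
proof -
  have "{1..2} = {1, 2::nat}" by auto
  then show ?thesis using assms trees_pair[of 1 "2::nat"] by auto
qed

lemma growth_op_1: "growth_op \<alpha> \<gamma> 1 f s = f (Node {|Leaf 1, Leaf 2|})"
  by (simp add: growth_op_def growth_step_def)

lemma chain_op_2:
  assumes "t \<in> trees {1..2}"
  shows "chain_op \<alpha> \<gamma> 2 g t = g t"
proof -
  have "chain_op \<alpha> \<gamma> 2 g t = down_op \<alpha> \<gamma> 2 (growth_op \<alpha> \<gamma> 1 g) t"
    using chain_op_eq[OF params _ assms] by simp
  also have "growth_op \<alpha> \<gamma> 1 g = (\<lambda>_. g t)" unfolding growth_op_1 trees_12[OF assms] ..
  finally show ?thesis by (simp add: down_op_const[OF params])
qed

lemma chain_op_power_tendsto: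
  assumes "1 \<le> n" "t \<in> trees {1..n}"
  shows "(\<lambda>r. (chain_op \<alpha> \<gamma> n ^^ r) f t) \<longlonglongrightarrow> growth_mean \<alpha> \<gamma> (n - 1) f"
  using assms
proof (induction n arbitrary: t f rule: nat_induct_at_least)
  case base
  then have t: "t = Leaf 1" using trees_singleton[of "1::nat"] by (simp del: One_nat_def)
  have "(chain_op \<alpha> \<gamma> 1 ^^ r) f t = f t" for r
    by (induction r) (auto simp: chain_op_def chain_step_def)
  then show ?case by (simp add: t)
next
  case (Suc m)
  define A where "A = (\<lambda>g. growth_op \<alpha> \<gamma> m (down_op \<alpha> \<gamma> (Suc m) g))"
  show ?case
  proof (cases "m = 1")
    \<comment> \<open>The commutation needs at least two leaves below. With two leaves there is only
      one tree, so the chain is constant.\<close>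
    case True
    then have t: "t \<in> trees {1..2}" using Suc.prems by (simp add: numeral_2_eq_2)
    have "(chain_op \<alpha> \<gamma> 2 ^^ r) f t = f t" for r
      by (induction r) (simp_all add: chain_op_2[OF t])
    then show ?thesis
      using True growth_op_1[of f] trees_12[OF t] by (simp add: numeral_2_eq_2)
  next
    case False
    then have m: "2 \<le> m" using Suc.hyps by simp
    define p where "p = (1 + real m / (real m - \<alpha>)) / (real m + 1)"
    have A: "A g s = p * g s + (1 - p) * chain_op \<alpha> \<gamma> m g s" if "s \<in> trees {1..m}" for g s
      unfolding A_def p_def by (rule growth_down_commute[OF params m that])
    have lim: "(\<lambda>r. (A ^^ r) h s) \<longlonglongrightarrow> growth_mean \<alpha> \<gamma> (m - 1) h" if s: "s \<in> trees {1..m}" for h s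
    proof (cases "m = 2")
      \<comment> \<open>For two leaves and \<alpha> = 1 the constant \<open>p\<close> equals 1 and
        the lazy steps carry no information on \<open>K\<close>. But \<open>K\<close> is the
        identity on the single tree with two leaves, and hence so is \<open>A\<close>.\<close>
      case True
      then have s: "s \<in> trees {1..2}" using s by simp
      have "A g s = g s" for g
        using A[of s g] s chain_op_2[OF s] True by (simp add: algebra_simps)
      then have "(A ^^ r) h s = h s" for r by (induction r) auto
      moreover have "growth_mean \<alpha> \<gamma> (m - 1) h = h s"
        using True growth_op_1[of h] trees_12[OF s] by simp
      ultimately show ?thesis by simp
    next
      case False
      then have "3 \<le> m" using m by simp
      \<comment> \<open>\<open>p < 1\<close> is equivalent to \<open>m - \<alpha> > 1\<close>, which
        holds from three leaves on.\<close>
      have "real m / (real m - \<alpha>) < real m"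
        using \<open>3 \<le> m\<close> params mult_strict_left_mono[of 1 "real m - \<alpha>" "real m"]
        by (simp add: field_simps)
      then have p: "0 \<le> p" "p < 1" using \<open>3 \<le> m\<close> params by (auto simp: p_def)
      have m1: "1 \<le> m" using m by simp
      show ?thesis
        by (rule lazy_powers_tendsto[where S = "trees {1..m}" and K = "chain_op \<alpha> \<gamma> m" and p = p,
              OF chain_op_linear[OF params m1] chain_op_cong[OF params m1] p A s Suc.IH[OF s]])
    qed
    \<comment> \<open>This identifies the limit: the lazy powers are applied to
      \<open>growth_op \<alpha> \<gamma> m f\<close>, their limit does not depend on the tree and
      survives the averaging of the down step, and the recursion of \<open>growth_mean\<close>
      absorbs the growth step.\<close>
    have "(\<lambda>r. down_op \<alpha> \<gamma> (Suc m) ((A ^^ r) (growth_op \<alpha> \<gamma> m f)) t) \<longlonglongrightarrow>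
        growth_mean \<alpha> \<gamma> (m - 1) (growth_op \<alpha> \<gamma> m f)"
      using m Suc.prems lim by (intro down_op_tendsto) auto
    also have "growth_mean \<alpha> \<gamma> (m - 1) (growth_op \<alpha> \<gamma> m f) = growth_mean \<alpha> \<gamma> m f"
      using m by (cases m) auto
    finally have "(\<lambda>r. (chain_op \<alpha> \<gamma> (Suc m) ^^ Suc r) f t) \<longlonglongrightarrow> growth_mean \<alpha> \<gamma> m f"
      unfolding chain_op_power_Suc[OF m Suc.prems] A_def .
    then show ?thesis unfolding diff_Suc_1 by (rule LIMSEQ_imp_Suc)
  qed
qed

end

section \<open>One-dimensional laws of Markov processes\<close>

context
  fixes M :: "'w measure" and S :: "nat \<Rightarrow> 'a set" and K :: "nat \<Rightarrow> 'a \<Rightarrow> 'a pmf"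
    and X :: "nat \<Rightarrow> 'w \<Rightarrow> 'a"
  assumes markov: "markov_process M S K X" and fin: "\<And>m. finite (S m)"
begin

interpretation prob_space M
  using markov by (simp add: markov_process_def)

lemma X_measurable: "X m \<in> measurable M (count_space (S m))"
  using markov by (simp add: markov_process_def)

lemma X_in: "\<omega> \<in> space M \<Longrightarrow> X m \<omega> \<in> S m"
  using measurable_space[OF X_measurable] by simp

lemma X_event: "{\<omega> \<in> space M. X m \<omega> = x} \<in> events"
proof (cases "x \<in> S m")
  case True
  have "X m -` {x} \<inter> space M \<in> events"
    by (rule measurable_sets[OF X_measurable]) (use True in auto)
  moreover have "X m -` {x} \<inter> space M = {\<omega> \<in> space M. X m \<omega> = x}" by auto
  ultimately show ?thesis by simp
next
  case False
  then have "{\<omega> \<in> space M. X m \<omega> = x} = {}" using X_in by auto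
  then show ?thesis by (simp only: sets.empty_sets)
qed

lemma path_event: "{\<omega> \<in> space M. \<forall>k\<le>m. X k \<omega> = x k} \<in> events"
proof -
  have "{\<omega> \<in> space M. \<forall>k\<le>m. X k \<omega> = x k} = (\<Inter>k\<in>{..m}. {\<omega> \<in> space M. X k \<omega> = x k})" by auto
  then show ?thesis using X_event by (auto intro!: sets.finite_INT)
qed

lemma expectation_markov:
  fixes f :: "'a \<Rightarrow> real"
  shows "expectation (\<lambda>\<omega>. f (X m \<omega>)) = (\<Sum>x\<in>S m. f x * prob {\<omega> \<in> space M. X m \<omega> = x})"
proof -
  have "expectation (\<lambda>\<omega>. f (X m \<omega>)) =
      expectation (\<lambda>\<omega>. \<Sum>x\<in>S m. f x * indicator {\<omega> \<in> space M. X m \<omega> = x} \<omega>)"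
  proof (rule Bochner_Integration.integral_cong[OF refl])
    fix \<omega> assume \<omega>: "\<omega> \<in> space M"
    have "(\<Sum>x\<in>S m. f x * indicator {\<omega> \<in> space M. X m \<omega> = x} \<omega>) =
        (\<Sum>x\<in>S m. if X m \<omega> = x then f x else 0)"
      using \<omega> by (intro sum.cong) (auto simp: indicator_def)
    then show "f (X m \<omega>) = (\<Sum>x\<in>S m. f x * indicator {\<omega> \<in> space M. X m \<omega> = x} \<omega>)"
      using X_in[OF \<omega>] fin by simp
  qed
  also have "\<dots> = (\<Sum>x\<in>S m. f x * prob {\<omega> \<in> space M. X m \<omega> = x})"
    using X_event[of m]
    by (subst Bochner_Integration.integral_sum) (auto simp: emeasure_eq_measure)
  finally show ?thesis .
qed

text \<open>\<open>markov_process\<close> speaks of whole paths only, so events are cut along the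
  finitely many paths up to time \<open>m\<close>. Extensional functions represent each path exactly
  once, which makes the pieces disjoint.\<close>

lemma prob_split_paths:
  assumes "B \<in> events"
  shows "prob B = (\<Sum>x\<in>(\<Pi>\<^sub>E k\<in>{..m}. S k). prob (B \<inter> {\<omega> \<in> space M. \<forall>k\<le>m. X k \<omega> = x k}))"
proof -
  let ?P = "\<Pi>\<^sub>E k\<in>{..m}. S k" and ?C = "\<lambda>x. {\<omega> \<in> space M. \<forall>k\<le>m. X k \<omega> = x k}"
  have "B = (\<Union>x\<in>?P. B \<inter> ?C x)"
  proof (intro equalityI subsetI)
    fix \<omega> assume \<omega>: "\<omega> \<in> B"
    then have "\<omega> \<in> space M" using assms sets.sets_into_space by auto
    then have "restrict (\<lambda>k. X k \<omega>) {..m} \<in> ?P" "\<omega> \<in> ?C (restrict (\<lambda>k. X k \<omega>) {..m})"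
      using X_in by auto
    then show "\<omega> \<in> (\<Union>x\<in>?P. B \<inter> ?C x)" using \<omega> by blast
  qed auto
  moreover have "prob (\<Union>x\<in>?P. B \<inter> ?C x) = (\<Sum>x\<in>?P. prob (B \<inter> ?C x))"
  proof (rule finite_measure_finite_Union)
    show "finite ?P" using fin by (intro finite_PiE) auto
    show "(\<lambda>x. B \<inter> ?C x) ` ?P \<subseteq> events"
      by (intro image_subsetI sets.Int assms path_event)
    show "disjoint_family_on (\<lambda>x. B \<inter> ?C x) ?P"
      unfolding disjoint_family_on_def
    proof (intro ballI impI)
      fix x y assume *: "x \<in> ?P" "y \<in> ?P" "x \<noteq> y"
      then obtain k where "k \<le> m" "x k \<noteq> y k" by (metis PiE_ext atMost_iff)
      then show "(B \<inter> ?C x) \<inter> (B \<inter> ?C y) = {}" by auto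
    qed
  qed
  ultimately show ?thesis by simp
qed

text \<open>The path identity is summed over all pasts, which are then grouped by their value at
  time \<open>m\<close>; on each group the transition probability is constant.\<close>

lemma prob_Suc:
  assumes y: "y \<in> S (Suc m)"
  shows "prob {\<omega> \<in> space M. X (Suc m) \<omega> = y} =
    (\<Sum>x\<in>S m. prob {\<omega> \<in> space M. X m \<omega> = x} * pmf (K m x) y)"
proof -
  let ?P = "\<Pi>\<^sub>E k\<in>{..m}. S k" and ?C = "\<lambda>x. {\<omega> \<in> space M. \<forall>k\<le>m. X k \<omega> = x k}"
  have "prob ({\<omega> \<in> space M. X (Suc m) \<omega> = y} \<inter> ?C x) = prob (?C x) * pmf (K m (x m)) y"
    if x: "x \<in> ?P" for x
  proof -
    define x' where "x' = x(Suc m := y)"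
    have "\<forall>k\<le>Suc m. x' k \<in> S k" using x y by (auto simp: x'_def PiE_iff)
    then have "prob {\<omega> \<in> space M. \<forall>k\<le>Suc m. X k \<omega> = x' k} =
        prob {\<omega> \<in> space M. \<forall>k\<le>m. X k \<omega> = x' k} * pmf (K m (x' m)) (x' (Suc m))"
      using markov unfolding markov_process_def by blast
    moreover have "{\<omega> \<in> space M. \<forall>k\<le>Suc m. X k \<omega> = x' k} = {\<omega> \<in> space M. X (Suc m) \<omega> = y} \<inter> ?C x"
      by (auto simp: x'_def le_Suc_eq)
    moreover have "{\<omega> \<in> space M. \<forall>k\<le>m. X k \<omega> = x' k} = ?C x" by (auto simp: x'_def)
    ultimately show ?thesis by (simp add: x'_def)
  qed
  then have "prob {\<omega> \<in> space M. X (Suc m) \<omega> = y} = (\<Sum>x\<in>?P. prob (?C x) * pmf (K m (x m)) y)"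
    using prob_split_paths[OF X_event, of "Suc m" y m] by simp
  also have "\<dots> = (\<Sum>x\<in>?P. \<Sum>z\<in>S m. (if x m = z then prob (?C x) * pmf (K m z) y else 0))"
    using fin by (intro sum.cong refl) (auto simp: PiE_iff)
  also have "\<dots> = (\<Sum>z\<in>S m. \<Sum>x\<in>?P. (if x m = z then prob (?C x) * pmf (K m z) y else 0))"
    by (rule sum.swap)
  also have "\<dots> = (\<Sum>z\<in>S m. prob {\<omega> \<in> space M. X m \<omega> = z} * pmf (K m z) y)"
  proof (rule sum.cong[OF refl])
    fix z
    have "prob ({\<omega> \<in> space M. X m \<omega> = z} \<inter> ?C x) = (if x m = z then prob (?C x) else 0)" for x
    proof (cases "x m = z")
      case True
      then have "{\<omega> \<in> space M. X m \<omega> = z} \<inter> ?C x = ?C x" by auto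
      then show ?thesis using True by simp
    next
      case False
      then have "{\<omega> \<in> space M. X m \<omega> = z} \<inter> ?C x = {}" by auto
      then show ?thesis using False by (simp del: Int_Collect)
    qed
    then have "prob {\<omega> \<in> space M. X m \<omega> = z} = (\<Sum>x\<in>?P. if x m = z then prob (?C x) else 0)"
      using prob_split_paths[OF X_event, of m z m] by simp
    then show "(\<Sum>x\<in>?P. (if x m = z then prob (?C x) * pmf (K m z) y else 0)) =
        prob {\<omega> \<in> space M. X m \<omega> = z} * pmf (K m z) y"
      by (simp add: sum_distrib_right if_distrib[of "\<lambda>a. a * _"] cong: if_cong)
  qed
  finally show ?thesis .
qed

lemma expectation_markov_Suc:
  fixes f :: "'a \<Rightarrow> real"
  assumes K: "\<And>x. x \<in> S m \<Longrightarrow> set_pmf (K m x) \<subseteq> S (Suc m)"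
  shows "expectation (\<lambda>\<omega>. f (X (Suc m) \<omega>)) =
    expectation (\<lambda>\<omega>. measure_pmf.expectation (K m (X m \<omega>)) f)"
proof -
  have "expectation (\<lambda>\<omega>. f (X (Suc m) \<omega>)) =
      (\<Sum>y\<in>S (Suc m). \<Sum>x\<in>S m. f y * (prob {\<omega> \<in> space M. X m \<omega> = x} * pmf (K m x) y))"
    unfolding expectation_markov by (simp add: prob_Suc sum_distrib_left)
  also have "\<dots> = (\<Sum>x\<in>S m. \<Sum>y\<in>S (Suc m). f y * (prob {\<omega> \<in> space M. X m \<omega> = x} * pmf (K m x) y))"
    by (rule sum.swap)
  also have "\<dots> = (\<Sum>x\<in>S m. measure_pmf.expectation (K m x) f * prob {\<omega> \<in> space M. X m \<omega> = x})"
  proof (rule sum.cong[OF refl])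
    fix x assume "x \<in> S m"
    then have "measure_pmf.expectation (K m x) f = (\<Sum>y\<in>S (Suc m). f y * pmf (K m x) y)"
      using K fin by (intro integral_measure_pmf_real) auto
    then show "(\<Sum>y\<in>S (Suc m). f y * (prob {\<omega> \<in> space M. X m \<omega> = x} * pmf (K m x) y)) =
        measure_pmf.expectation (K m x) f * prob {\<omega> \<in> space M. X m \<omega> = x}"
      by (simp add: sum_distrib_right algebra_simps)
  qed
  also have "\<dots> = expectation (\<lambda>\<omega>. measure_pmf.expectation (K m (X m \<omega>)) f)"
    by (rule expectation_markov[symmetric])
  finally show ?thesis .
qed

end

section \<open>Expectations along the two processes and the limit\<close>

lemma growth_process_mean:
  fixes T :: "nat \<Rightarrow> 'v \<Rightarrow> nat ltree"
  assumes params: "0 \<le> \<gamma>" "\<gamma> \<le> \<alpha>" "\<alpha> \<le> 1" and T: "growth_process \<alpha> \<gamma> N T"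
  shows "(\<integral>\<omega>. f (T (Suc n) \<omega>) \<partial>N) = growth_mean \<alpha> \<gamma> n f"
proof (induction n arbitrary: f)
  case 0
  note markov = T[unfolded growth_process_def]
  interpret prob_space N using markov by (simp add: markov_process_def)
  have "T (Suc 0) \<omega> = Leaf 1" if "\<omega> \<in> space N" for \<omega>
    using X_in[OF markov finite_trees that, of 0] trees_singleton[of "1::nat"] by simp
  then have "(\<integral>\<omega>. f (T (Suc 0) \<omega>) \<partial>N) = (\<integral>\<omega>. f (Leaf 1) \<partial>N)"
    by (intro Bochner_Integration.integral_cong) auto
  then show ?case by (simp add: prob_space)
next
  case (Suc n)
  note markov = T[unfolded growth_process_def]
  have "(\<integral>\<omega>. f (T (Suc (Suc n)) \<omega>) \<partial>N) =
      (\<integral>\<omega>. measure_pmf.expectation (growth_step \<alpha> \<gamma> (Suc n) (T (Suc n) \<omega>)) f \<partial>N)"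
    using expectation_markov_Suc[OF markov finite_trees, of n f] set_growth_step[OF params, of "Suc n"]
    by simp
  then show ?case using Suc.IH[of "growth_op \<alpha> \<gamma> (Suc n) f"] by (simp add: growth_op_def[abs_def])
qed

lemma alpha_gamma_chain_expectation:
  fixes X :: "nat \<Rightarrow> 'w \<Rightarrow> nat ltree"
  assumes params: "0 \<le> \<gamma>" "\<gamma> \<le> \<alpha>" "\<alpha> \<le> 1" and n: "1 \<le> n"
    and X: "alpha_gamma_chain \<alpha> \<gamma> n M X"
  shows "(\<integral>\<omega>. f (X m \<omega>) \<partial>M) = (\<integral>\<omega>. (chain_op \<alpha> \<gamma> n ^^ m) f (X 0 \<omega>) \<partial>M)"
proof (induction m arbitrary: f)
  case (Suc m)
  note markov = X[unfolded alpha_gamma_chain_def]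
  have "(\<integral>\<omega>. f (X (Suc m) \<omega>) \<partial>M) = (\<integral>\<omega>. chain_op \<alpha> \<gamma> n f (X m \<omega>) \<partial>M)"
    unfolding chain_op_def
    using expectation_markov_Suc[OF markov finite_trees, where m = m and f = f] set_chain_step[OF params n] by simp
  then show ?case using Suc.IH by (simp add: funpow_swap1)
qed simp

theorem theorem1p2:
  fixes \<alpha> \<gamma> :: real and n :: nat
    and M :: "'w measure" and X :: "nat \<Rightarrow> 'w \<Rightarrow> nat ltree"
    and N :: "'v measure" and T :: "nat \<Rightarrow> 'v \<Rightarrow> nat ltree"
  assumes "0 \<le> \<gamma>" and "\<gamma> \<le> \<alpha>" and "\<alpha> \<le> 1" and "n \<ge> 1"
    and "alpha_gamma_chain \<alpha> \<gamma> n M X"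
    and "growth_process \<alpha> \<gamma> N T"
  shows "converges_in_distribution M X N (T n)"
  unfolding converges_in_distribution_def
proof (intro allI impI)
  fix f :: "nat ltree \<Rightarrow> real"
  note params = assms(1-3)
  note markov = assms(5)[unfolded alpha_gamma_chain_def]
  interpret prob_space M using markov by (simp add: markov_process_def)
  let ?q = "\<lambda>x. prob {\<omega> \<in> space M. X 0 \<omega> = x}"
  define c where "c = growth_mean \<alpha> \<gamma> (n - 1) f"
  have E: "expectation (\<lambda>\<omega>. g (X 0 \<omega>)) = (\<Sum>x\<in>trees {1..n}. g x * ?q x)" for g :: "nat ltree \<Rightarrow> real"
    by (rule expectation_markov[OF markov finite_trees]) simp
  \<comment> \<open>The initial law is arbitrary, but the expectation is a finite mixture over the
    starting tree of sequences that all have the limit \<open>c\<close>.\<close>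
  have "(\<lambda>m. \<Sum>x\<in>trees {1..n}. (chain_op \<alpha> \<gamma> n ^^ m) f x * ?q x) \<longlonglongrightarrow> (\<Sum>x\<in>trees {1..n}. c * ?q x)"
    unfolding c_def by (intro tendsto_intros chain_op_power_tendsto[OF params assms(4)])
  also have "(\<Sum>x\<in>trees {1..n}. c * ?q x) = c"
    using E[of "\<lambda>_. c"] by (simp add: prob_space)
  finally have "(\<lambda>m. \<integral>\<omega>. f (X m \<omega>) \<partial>M) \<longlonglongrightarrow> c"
    by (subst trans[OF alpha_gamma_chain_expectation[OF params assms(4,5)] E])
  moreover have "(\<integral>\<omega>. f (T n \<omega>) \<partial>N) = c"
    using growth_process_mean[OF params assms(6), of f "n - 1"] assms(4) by (simp add: c_def)
  ultimately show "(\<lambda>m. \<integral>\<omega>. f (X m \<omega>) \<partial>M) \<longlonglongrightarrow> (\<integral>\<omega>. f (T n \<omega>) \<partial>N)" by simp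
qed

end
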